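(* Let $C\subseteq\mathbb{R}^\infty_{\ge0}$ be a rational cone that is $\mathrm{Sym}$-equivariantly finitely generated. Then $M=C\cap\mathbb{Z}^\infty$ is a $\mathrm{Sym}$-equivariantly finitely generated normal monoid, i.e. there is a finite set $B\subset\mathbb{Z}^\infty$ with $M=\mathrm{mn}(\mathrm{Sym}(B))$.
   Context: $\mathbb{R}^\infty$ ($\mathbb{Z}^\infty$) is the set of real (integer) sequences with finitely many nonzero entries; $\mathbb{R}^\infty_{\ge0}$ those with nonnegative entries. $\mathrm{Sym}$ is the group of permutations of $\mathbb{N}$ fixing all but finitely many elements, acting by $\sigma(u)=(u_{\sigma^{-1}(1)},u_{\sigma^{-1}(2)},\dots)$; $\mathrm{Sym}(A)$ is the set of all $\sigma(a)$. $\mathrm{cn}(A)$ (resp. $\mathrm{mn}(A)$) is the set of finite linear combinations of elements of $A$ with nonnegative real (resp. nonnegative integer) coefficients. $C$ is $\mathrm{Sym}$-equivariantly finitely generated if $C=\mathrm{cn}(\mathrm{Sym}(A))$ for a finite set $A$, and rational if it is generated (as a cone) by elements with rational coordinates. A monoid $M\subseteq\mathbb{Z}^{\mathbb{N}}$ is normal if every $u\in\mathbb{Z}^{\mathbb{N}}$ with $ku\in M$ for some positive integer $k$ lies in $M$. *)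

theory Defs
  imports Complex_Main "HOL-Combinatorics.Perm"
begin

text \<open>
  All sequences live in \<^typ>\<open>nat \<Rightarrow> real\<close>; integer and rational sequences are real sequences
  with entries in \<open>\<int>\<close> and \<open>\<rat>\<close>. The coordinates are numbered from 0. The type \<^typ>\<open>nat perm\<close> is
  the group of permutations of the naturals that fix all but finitely many elements.
\<close>

definition R_inf :: "(nat \<Rightarrow> real) set" where
  "R_inf = {u. finite {i. u i \<noteq> 0}}"

definition R_inf_nonneg :: "(nat \<Rightarrow> real) set" where
  "R_inf_nonneg = {u \<in> R_inf. \<forall>i. 0 \<le> u i}"

definition Z_seq :: "(nat \<Rightarrow> real) set" where
  "Z_seq = {u. \<forall>i. u i \<in> \<int>}"

definition Z_inf :: "(nat \<Rightarrow> real) set" where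
  "Z_inf = R_inf \<inter> Z_seq"

definition Q_inf :: "(nat \<Rightarrow> real) set" where
  "Q_inf = {u \<in> R_inf. \<forall>i. u i \<in> \<rat>}"

definition perm_act :: "nat perm \<Rightarrow> (nat \<Rightarrow> real) \<Rightarrow> nat \<Rightarrow> real" where
  "perm_act \<sigma> u = (\<lambda>i. u (Perm.apply (inverse \<sigma>) i))"

definition Sym :: "(nat \<Rightarrow> real) set \<Rightarrow> (nat \<Rightarrow> real) set" where
  "Sym A = {perm_act \<sigma> a | \<sigma> a. a \<in> A}"

definition cn :: "(nat \<Rightarrow> real) set \<Rightarrow> (nat \<Rightarrow> real) set" where
  "cn A = {(\<lambda>i. \<Sum>a\<in>F. c a * a i) | F (c :: (nat \<Rightarrow> real) \<Rightarrow> real).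
             finite F \<and> F \<subseteq> A \<and> (\<forall>a\<in>F. 0 \<le> c a)}"

definition mn :: "(nat \<Rightarrow> real) set \<Rightarrow> (nat \<Rightarrow> real) set" where
  "mn A = {(\<lambda>i. \<Sum>a\<in>F. of_nat (c a) * a i) | F (c :: (nat \<Rightarrow> real) \<Rightarrow> nat).
             finite F \<and> F \<subseteq> A}"

definition Sym_fg_cone :: "(nat \<Rightarrow> real) set \<Rightarrow> bool" where
  "Sym_fg_cone C \<longleftrightarrow> (\<exists>A. finite A \<and> A \<subseteq> R_inf \<and> C = cn (Sym A))"

definition rational_cone :: "(nat \<Rightarrow> real) set \<Rightarrow> bool" where
  "rational_cone C \<longleftrightarrow> (\<exists>G. G \<subseteq> Q_inf \<and> C = cn G)"

definition normal_monoid :: "(nat \<Rightarrow> real) set \<Rightarrow> bool" where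
  "normal_monoid M \<longleftrightarrow>
     M \<subseteq> Z_seq \<and> (\<lambda>i. 0) \<in> M \<and> (\<forall>u\<in>M. \<forall>v\<in>M. (\<lambda>i. u i + v i) \<in> M) \<and>
     (\<forall>u\<in>Z_seq. (\<exists>k::nat. 0 < k \<and> (\<lambda>i. of_nat k * u i) \<in> M) \<longrightarrow> u \<in> M)"

definition Sym_fg_monoid :: "(nat \<Rightarrow> real) set \<Rightarrow> bool" where
  "Sym_fg_monoid M \<longleftrightarrow> (\<exists>B. finite B \<and> B \<subseteq> Z_inf \<and> M = mn (Sym B))"

end

theory Submission
  imports Defs
begin

text \<open>
  Write \<open>P\<^sub>k\<close> for the sum of the first \<open>k\<close> entries of a sequence. Clearing denominators, \<open>C\<close> has generators
  \<open>\<sigma>(a)\<close> with \<open>a\<close> in a finite set of weakly decreasing integer vectors supported on the first \<open>d\<close>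
  coordinates. Majorization then describes \<open>C\<close>: a decreasing \<open>u\<close> lies in \<open>C\<close> iff there are \<open>c\<^sub>a \<ge> 0\<close> with
  \<open>P\<^sub>k(u) \<le> \<Sum>\<^sub>a c\<^sub>a P\<^sub>k(a)\<close> for all \<open>k\<close> and equality for the full sums.

  If the irreducible elements of \<open>M\<close> were infinite in number up to symmetry, choose a sequence of decreasing
  ones. Along a subsequence the following natural numbers are increasing, each either constant or unbounded:
  the integer parts of the coefficients \<open>c\<^sub>a\<close>, the resulting slacks in the inequalities above, the gaps between
  consecutive entries among the first \<open>d\<close>, these entries, and the tail sums; moreover the vectors increase
  entrywise, since Young's lattice is a well-quasi-order. Let \<open>q\<close> be the position of the last unbounded gap.
  For \<open>u\<close> early and \<open>v\<close> late in the subsequence, \<open>v - u\<close> has the same largest \<open>q\<close> positions as \<open>u\<close> and \<open>v\<close>,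
  so the inequalities up to \<open>q\<close> are inherited, while after \<open>q\<close> it is so flat that concavity of \<open>k \<mapsto> P\<^sub>k(a)\<close> gives
  the remaining ones. Hence \<open>v - u \<in> M\<close> and \<open>v\<close> is reducible.
\<close>

section \<open>Subsequences of partitions\<close>

text \<open>Both alternatives are used when a pair of indices is chosen: a constant quantity yields
  an equality, an unbounded one eventually exceeds any threshold fixed by the earlier
  vector.\<close>

definition settled :: "(nat \<Rightarrow> nat) \<Rightarrow> bool" where
  "settled h \<longleftrightarrow> mono h \<and> ((\<forall>n. h n = h 0) \<or> filterlim h at_top sequentially)"

lemma settled_subseq:
  assumes "settled h" "strict_mono r"
  shows "settled (\<lambda>n. h (r n))"
proof -
  have "mono (\<lambda>n. h (r n))"
    using assms by (auto simp: settled_def mono_def strict_mono_less_eq)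
  moreover have "(\<forall>n. h (r n) = h (r 0)) \<or> filterlim (\<lambda>n. h (r n)) at_top sequentially"
    using assms filterlim_compose[OF _ filterlim_subseq[OF assms(2)], of h at_top]
    unfolding settled_def by metis
  ultimately show ?thesis by (simp add: settled_def)
qed

text \<open>Take a monotone subsequence. If it decreases, or increases and is bounded, it is
  eventually constant in the naturals and a shift makes it constant; otherwise it tends to
  infinity.\<close>

lemma ex_settled_subseq: "\<exists>r. strict_mono r \<and> settled (\<lambda>n. g (r n))" for g :: "nat \<Rightarrow> nat"
proof -
  obtain f where f: "strict_mono f" "monoseq (\<lambda>n. g (f n))"
    using seq_monosub[of g] by blast
  define h where "h = (\<lambda>n. g (f n))"
  have const: ?thesis if "\<And>n. n \<ge> N \<Longrightarrow> h n = h N" for N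
  proof (intro exI conjI)
    show "strict_mono (\<lambda>n. f (n + N))" using f(1) by (simp add: strict_mono_def)
    have "g (f (n + N)) = g (f N)" for n using that[of "n + N"] by (simp add: h_def)
    then show "settled (\<lambda>n. g (f (n + N)))" by (simp add: settled_def mono_def)
  qed
  consider "incseq h" | "decseq h"
    using f(2) by (auto simp: h_def monoseq_iff)
  then show ?thesis
  proof cases
    case 1
    show ?thesis
    proof (cases "\<exists>K. \<forall>n. h n \<le> K")
      case True
      then have fin: "finite (range h)"
        by (metis (no_types, lifting) finite_nat_set_iff_bounded_le rangeE)
      then have "Max (range h) \<in> range h" by (intro Max_in) auto
      then obtain N where "h N = Max (range h)" by (metis rangeE)
      then have "h n = h N" if "n \<ge> N" for n
        using that 1 Max_ge[OF fin, of "h n"] by (metis dual_order.antisym incseqD rangeI)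
      then show ?thesis by (rule const)
    next
      case False
      then have "filterlim h at_top sequentially"
        unfolding filterlim_at_top eventually_sequentially
        using 1 by (metis incseqD le_trans linorder_le_cases)
      then show ?thesis using 1 f(1) by (auto simp: settled_def h_def)
    qed
  next
    case 2
    obtain N where N: "\<And>n. h N \<le> h n"
      using ex_has_least_nat[of "\<lambda>_. True" _ h] by auto
    have "h n = h N" if "n \<ge> N" for n using decseqD[OF 2 that] N[of n] by simp
    then show ?thesis by (rule const)
  qed
qed

lemma ex_common_settled_subseq:
  fixes G :: "(nat \<Rightarrow> nat) set"
  assumes "finite G"
  shows "\<exists>r. strict_mono r \<and> (\<forall>g\<in>G. settled (\<lambda>n. g (r n)))"
  using assms
proof (induction G)
  case empty
  show ?case by (intro exI[of _ "\<lambda>n. n"]) (simp add: strict_mono_def)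
next
  case (insert g G)
  then obtain r where r: "strict_mono r" "\<forall>g\<in>G. settled (\<lambda>n. g (r n))" by blast
  obtain s where s: "strict_mono s" "settled (\<lambda>n. g (r (s n)))"
    using ex_settled_subseq[of "\<lambda>n. g (r n)"] by blast
  have "strict_mono (\<lambda>n. r (s n))" using r(1) s(1) by (simp add: strict_mono_def)
  moreover have "\<forall>g\<in>G. settled (\<lambda>n. g (r (s n)))"
    using r(2) settled_subseq[OF _ s(1)] by blast
  ultimately show ?case using s(2) by (intro exI[of _ "\<lambda>n. r (s n)"]) auto
qed

text \<open>Young's lattice is a well-quasi-order: a partition all of whose rows from \<open>s\<close> on have length
  at most \<open>H\<close> is determined, monotonically, by its first \<open>s\<close> rows and its first \<open>H\<close> columns.\<close>
lemma ex_increasing_subseq_partitions: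
  fixes f :: "nat \<Rightarrow> nat \<Rightarrow> nat"
  assumes anti: "\<And>n. antimono (f n)" and fin: "\<And>n. finite {i. f n i \<noteq> 0}"
  shows "\<exists>r. strict_mono r \<and> (\<forall>k. \<forall>\<^sub>F l in sequentially. f (r k) \<le> f (r l))"
proof (cases "\<exists>s H. \<forall>n. f n s \<le> H")
  case True
  then obtain s H where H: "\<And>n. f n s \<le> H" by blast
  \<comment> \<open>\<open>h c n\<close> is the length of column \<open>c\<close> in the diagram of
    \<open>f n\<close>, a part of the conjugate partition; the rows reaching \<open>c\<close> form
    an initial segment because \<open>f n\<close> is decreasing.\<close>
  define h where "h c n = card {i. c \<le> f n i}" for c n
  have fin': "finite {i. c \<le> f n i}" if "c > 0" for c n
    by (rule finite_subset[OF _ fin[of n]]) (use that in auto)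
  have col: "c \<le> f n i \<longleftrightarrow> i < h c n" if "c > 0" for c n i
  proof
    assume "c \<le> f n i"
    then have "{..i} \<subseteq> {i. c \<le> f n i}" using anti[of n] by (fastforce simp: antimono_def)
    from card_mono[OF fin'[OF that] this] show "i < h c n" by (simp add: h_def)
  next
    assume i: "i < h c n"
    show "c \<le> f n i"
    proof (rule ccontr)
      assume "\<not> c \<le> f n i"
      then have "{i. c \<le> f n i} \<subseteq> {..<i}"
        using anti[of n] by (auto simp: antimono_def) (metis le_trans not_less)
      from card_mono[OF _ this] i show False by (simp add: h_def)
    qed
  qed
  define G where "G = (\<lambda>i n. f n i) ` {..<s} \<union> h ` {1..H}"
  obtain r where r: "strict_mono r" "\<And>g. g \<in> G \<Longrightarrow> settled (\<lambda>n. g (r n))"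
    using ex_common_settled_subseq[of G] by (auto simp: G_def)
  have "f (r k) i \<le> f (r l) i" if "k \<le> l" for k l i
  proof (cases "i < s \<or> f (r k) i = 0")
    case True
    then show ?thesis
      using r(2)[of "\<lambda>n. f n i"] that by (auto simp: G_def settled_def mono_def)
  next
    case False
    \<comment> \<open>As \<open>s \<le> i\<close>, the length \<open>c\<close> of row
      \<open>i\<close> is at most \<open>H\<close>, so column \<open>c\<close> is one of those made
      increasing.\<close>
    define c where "c = f (r k) i"
    have "c \<le> f (r k) s" using anti[of "r k"] False by (auto simp: antimono_def c_def)
    then have c: "c > 0" "c \<le> H" using H[of "r k"] False by (auto simp: c_def)
    then have "h c (r k) \<le> h c (r l)"
      using r(2)[of "h c"] that by (auto simp: G_def settled_def mono_def)
    then show ?thesis using col[OF c(1)] by (metis c_def le_refl order_less_le_trans)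
  qed
  then show ?thesis
    using r(1) by (intro exI[of _ r]) (auto simp: le_fun_def eventually_sequentially)
next
  case False
  \<comment> \<open>Now every fixed row is unbounded along the sequence, so arbitrarily late members
    have row \<open>n\<close> of length at least \<open>n\<close>.\<close>
  have next_ex: "\<exists>l>m. f l n \<ge> n" for m n
  proof (rule ccontr)
    assume *: "\<not> ?thesis"
    have "f l n \<le> n + (\<Sum>j\<le>m. f j n)" for l
    proof (cases "l \<le> m")
      case True
      then have "f l n \<le> (\<Sum>j\<le>m. f j n)" by (intro member_le_sum) auto
      then show ?thesis by simp
    qed (use * in \<open>auto simp: not_le intro: less_imp_le trans_le_add1\<close>)
    then show False using False by blast
  qed
  have "\<exists>r. \<forall>n. f (r n) n \<ge> n \<and> r n < r (Suc n)"
    by (rule dependent_nat_choice) (use next_ex in auto)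
  then obtain r where r: "\<And>n. f (r n) n \<ge> n" "\<And>n. r n < r (Suc n)" by blast
  have "\<forall>\<^sub>F l in sequentially. f (r k) \<le> f (r l)" for k
  proof -
    obtain s where s: "\<And>i. f (r k) i \<noteq> 0 \<Longrightarrow> i < s"
      using fin[of "r k"] by (auto simp: finite_nat_set_iff_bounded)
    \<comment> \<open>For such \<open>l\<close> each of the first \<open>s\<close> rows of
      \<open>f (r l)\<close> has length at least \<open>l\<close>, hence at least the longest row of
      \<open>f (r k)\<close>; the remaining rows of \<open>f (r k)\<close> are empty.\<close>
    have "f (r k) i \<le> f (r l) i" if "l \<ge> s + f (r k) 0" for l i
    proof (cases "i < s")
      case True
      have "f (r k) i \<le> f (r k) 0" using anti[of "r k"] by (auto simp: antimono_def)
      also have "\<dots> \<le> f (r l) l" using r(1)[of l] that by simp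
      also have "\<dots> \<le> f (r l) i" using anti[of "r l"] that True by (auto simp: antimono_def)
      finally show ?thesis .
    next
      case False
      then have "f (r k) i = 0" using s by blast
      then show ?thesis by simp
    qed
    then show ?thesis by (auto simp: le_fun_def eventually_sequentially)
  qed
  then show ?thesis using r(2) by (auto simp: strict_mono_Suc_iff)
qed

text \<open>The earlier index is the first term of a subsequence along which everything is settled;
  the later one is so far out that the unbounded quantities have passed thresholds depending on the
  first vector. The family \<open>h\<close> leaves room for coefficients and slacks, and the last
  three conclusions are what \<open>subset_sums_le\<close> asks of the difference.\<close>

lemma ex_partition_pair:
  fixes f :: "nat \<Rightarrow> nat \<Rightarrow> nat" and h :: "'s \<Rightarrow> nat \<Rightarrow> nat"
  assumes anti: "\<And>n. antimono (f n)" and fin: "\<And>n. finite {i. f n i \<noteq> 0}"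
    and "finite S" and "d > 0"
  obtains k l q where "k < l" "q < d" "f k \<le> f l"
    "\<And>s. s \<in> S \<Longrightarrow> h s k \<le> h s l"
    "\<And>s K. s \<in> S \<Longrightarrow> (\<And>n. h s n \<le> K) \<Longrightarrow> h s k = h s l"
    "\<And>i. Suc i < d \<Longrightarrow> f l (Suc i) - f k (Suc i) \<le> f l i - f k i"
    "\<And>i j. i < q \<Longrightarrow> q \<le> j \<Longrightarrow> f l j - f k j \<le> f l i - f k i"
    "\<And>j. q \<le> j \<Longrightarrow> (d - q) * (f l j - f k j) \<le> (\<Sum>i | q \<le> i \<and> f l i \<noteq> 0. f l i - f k i)"
proof -
  obtain r1 where r1: "strict_mono r1" "\<And>k. \<forall>\<^sub>F l in sequentially. f (r1 k) \<le> f (r1 l)"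
    using ex_increasing_subseq_partitions[of f] anti fin by blast
  define gap where "gap i n = f n i - f n (Suc i)" for i n
  define tail where "tail q n = (\<Sum>i | q \<le> i \<and> f n i \<noteq> 0. f n i)" for q n
  define G where "G = (\<lambda>g n. g (r1 n)) ` (gap ` {..<d} \<union> (\<lambda>i n. f n i) ` {..<d} \<union> tail ` {..<d} \<union> h ` S)"
  have "finite G" using \<open>finite S\<close> by (auto simp: G_def)
  then obtain r2 where r2: "strict_mono r2" "\<And>g. g \<in> G \<Longrightarrow> settled (\<lambda>n. g (r2 n))"
    using ex_common_settled_subseq by blast
  define r where "r n = r1 (r2 n)" for n
  have smr: "strict_mono r" using r1(1) r2(1) by (simp add: strict_mono_def r_def)
  have gapS: "settled (\<lambda>n. gap i (r n))" if "i < d" for i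
    using r2(2)[of "\<lambda>n. gap i (r1 n)"] that by (auto simp: G_def r_def)
  have valS: "settled (\<lambda>n. f (r n) i)" if "i < d" for i
    using r2(2)[of "\<lambda>n. f (r1 n) i"] that by (auto simp: G_def r_def)
  have tailS: "settled (\<lambda>n. tail i (r n))" if "i < d" for i
    using r2(2)[of "\<lambda>n. tail i (r1 n)"] that by (auto simp: G_def r_def)
  have hS: "settled (\<lambda>n. h s (r n))" if "s \<in> S" for s
    using r2(2)[of "\<lambda>n. h s (r1 n)"] that by (auto simp: G_def r_def)
  \<comment> \<open>\<open>Suc i < d\<close> keeps the position after the last unbounded gap below
    \<open>d\<close>; \<open>q = 0\<close> stands for the absence of unbounded gaps. All gaps
    between positions \<open>q\<close> and \<open>d - 1\<close> are therefore constant.\<close>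
  define U where "U = {i. Suc i < d \<and> filterlim (\<lambda>n. gap i (r n)) at_top sequentially}"
  define q where "q = (if U = {} then 0 else Suc (Max U))"
  have finU: "finite U" by (rule finite_subset[of _ "{..<d}"]) (auto simp: U_def)
  have qd: "q < d"
    using Max_in[OF finU] \<open>d > 0\<close> by (auto simp: q_def U_def)
  have q_top: "filterlim (\<lambda>n. gap (q - 1) (r n)) at_top sequentially" if "q > 0"
    using that Max_in[OF finU] by (auto simp: q_def U_def split: if_splits)
  have q_const: "gap i (r n) = gap i (r 0)" if "q \<le> i" "Suc i < d" for i n
  proof -
    have "i \<notin> U" using Max_ge[OF finU, of i] that by (auto simp: q_def split: if_splits)
    then show ?thesis using gapS[of i] that by (auto simp: U_def settled_def)
  qed
  define u where "u = f (r 0)"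
  have ev1: "\<forall>\<^sub>F l in sequentially. u \<le> f (r l)"
    using r1(2)[of "r2 0"] filterlim_subseq[OF r2(1)]
    unfolding u_def r_def filterlim_iff by blast
  \<comment> \<open>This makes entry \<open>q - 1\<close> of the difference at least the whole entry
    \<open>q\<close> of the later vector, and so at least every later entry of the
    difference.\<close>
  have ev2: "\<forall>\<^sub>F l in sequentially. q > 0 \<longrightarrow> u (q - 1) \<le> gap (q - 1) (r l)"
    using q_top unfolding filterlim_at_top by (cases "q > 0") auto
  \<comment> \<open>The margin \<open>d * u q\<close> here and in \<open>ev4\<close> pays for an
    error of at most \<open>u q\<close> that occurs \<open>d - q\<close> times in the averaging
    bound \<open>big\<close>.\<close>
  have ev3: "\<forall>\<^sub>F l in sequentially. f (r l) q = u q \<or> u q + d * u q \<le> f (r l) q"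
    using valS[OF qd] unfolding settled_def filterlim_at_top u_def
    by (auto elim: eventually_mono)
  have ev4: "\<forall>\<^sub>F l in sequentially. tail q (r l) = tail q (r 0) \<or>
      tail q (r 0) + d * u q \<le> tail q (r l)"
    using tailS[OF qd] unfolding settled_def filterlim_at_top
    by (auto elim: eventually_mono)
  have "\<forall>\<^sub>F l in sequentially. 0 < l \<and> u \<le> f (r l) \<and> (q > 0 \<longrightarrow> u (q - 1) \<le> gap (q - 1) (r l)) \<and>
      (f (r l) q = u q \<or> u q + d * u q \<le> f (r l) q) \<and>
      (tail q (r l) = tail q (r 0) \<or> tail q (r 0) + d * u q \<le> tail q (r l))"
    using eventually_gt_at_top[of 0] ev1 ev2 ev3 ev4 by eventually_elim blast
  from eventually_happens'[OF sequentially_bot this] obtain l where l: "0 < l" "u \<le> f (r l)" "q > 0 \<longrightarrow> u (q - 1) \<le> gap (q - 1) (r l)"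
      "f (r l) q = u q \<or> u q + d * u q \<le> f (r l) q"
      "tail q (r l) = tail q (r 0) \<or> tail q (r 0) + d * u q \<le> tail q (r l)"
    by blast
  define v where "v = f (r l)"
  have uv: "u i \<le> v i" for i using l(2) by (simp add: le_fun_def v_def)
  have ua: "u j \<le> u i" and va: "v j \<le> v i" if "i \<le> j" for i j
    using anti[of "r 0"] anti[of "r l"] that by (auto simp: antimono_def u_def v_def)
  have gap_mono: "u i - u (Suc i) \<le> v i - v (Suc i)" if "i < d" for i
    using gapS[OF that] by (auto simp: settled_def mono_def gap_def u_def v_def)
  have step: "v (Suc i) - u (Suc i) \<le> v i - u i" if "Suc i < d" for i
    using gap_mono[of i] that uv[of i] uv[of "Suc i"] ua[of i "Suc i"] va[of i "Suc i"] by linarith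
  have le_top: "v (q - 1) - u (q - 1) \<le> v i - u i" if "i < q" for i
  proof -
    have "i \<le> q - 1" using that by simp
    then show ?thesis
    proof (induction i rule: inc_induct)
      case (step n)
      then show ?case using \<open>\<And>i. Suc i < d \<Longrightarrow> v (Suc i) - u (Suc i) \<le> v i - u i\<close>[of n] qd that by linarith
    qed simp
  qed
  have top: "v j - u j \<le> v i - u i" if "i < q" "q \<le> j" for i j
  proof -
    have "v j \<le> v q" using va that by blast
    moreover have "u (q - 1) \<le> v (q - 1) - v q"
      using l(3) that by (simp add: gap_def v_def)
    moreover have "v q \<le> v (q - 1)" by (intro va) simp
    ultimately have "v j - u j \<le> v (q - 1) - u (q - 1)"
      using uv[of "q - 1"] by linarith
    then show ?thesis using le_top[OF that(1)] by linarith
  qed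
  define g where "g = v q - u q"
  \<comment> \<open>Constant gaps make the difference constant on the block from \<open>q\<close> to
    \<open>d - 1\<close>.\<close>
  have flat: "v i - u i = g" if "q \<le> i" "i < d" for i
    using that
  proof (induction i rule: dec_induct)
    case (step n)
    have "gap n (r l) = gap n (r 0)" using q_const[of n] step by simp
    then have "u n - u (Suc n) = v n - v (Suc n)" by (simp add: gap_def u_def v_def)
    then show ?case
      using step uv[of n] uv[of "Suc n"] ua[of n "Suc n"] va[of n "Suc n"] by simp
  qed (simp add: g_def)
  define D where "D = {i. q \<le> i \<and> v i \<noteq> 0}"
  have finD: "finite D" by (rule finite_subset[OF _ fin[of "r l"]]) (auto simp: D_def v_def)
  have pos: "0 < v i" if "0 < u i" for i using uv[of i] that by simp
  have tail_u: "tail q (r 0) = sum u D"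
    unfolding tail_def u_def[symmetric]
    by (rule sum.mono_neutral_left) (use finD pos in \<open>auto simp: D_def\<close>)
  have tail_v: "tail q (r l) = sum v D" by (simp add: tail_def v_def D_def)
  have tail_diff: "(\<Sum>i\<in>D. v i - u i) + sum u D = sum v D"
    using uv by (simp flip: sum.distrib)
  \<comment> \<open>If entry \<open>q\<close> is unchanged, each entry of the difference is at most
    \<open>u q\<close>, and the tail sums either agree, forcing zero, or differ by at least
    \<open>d * u q\<close>. If entry \<open>q\<close> has grown, the block contributes
    \<open>d - q\<close> copies of \<open>g\<close>; an entry exceeding \<open>g\<close> lies
    outside the block and itself adds at least \<open>d * u q\<close>.\<close>
  have big: "(d - q) * (v j - u j) \<le> (\<Sum>i\<in>D. v i - u i)" if j: "q \<le> j" for j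
  proof (cases "j \<in> D")
    case False
    then show ?thesis using j by (auto simp: D_def)
  next
    case jD: True
    have vj: "v j \<le> v q" using va j by blast
    from l(4) show ?thesis
    proof
      assume eq: "f (r l) q = u q"
      from l(5) show ?thesis
      proof
        assume "tail q (r l) = tail q (r 0)"
        then have "(\<Sum>i\<in>D. v i - u i) = 0" using tail_u tail_v tail_diff by simp
        then show ?thesis using jD finD by simp
      next
        assume "tail q (r 0) + d * u q \<le> tail q (r l)"
        then have "d * u q \<le> (\<Sum>i\<in>D. v i - u i)" using tail_u tail_v tail_diff by simp
        moreover have "(d - q) * (v j - u j) \<le> d * u q"
          using vj eq by (intro mult_le_mono) (auto simp: v_def)
        ultimately show ?thesis by linarith
      qed
    next
      assume "u q + d * u q \<le> f (r l) q"
      then have g: "d * u q \<le> g" "v q = g + u q" using uv[of q] by (auto simp: g_def v_def)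
      have blk: "sum (\<lambda>i. v i - u i) {q..<d} = (d - q) * g" using flat by simp
      have outside: "v i - u i = 0" if "q \<le> i" "i \<notin> D" for i using that by (simp add: D_def)
      show ?thesis
      proof (cases "v j - u j \<le> g")
        case True
        have "(d - q) * (v j - u j) \<le> (d - q) * g" using True by simp
        also have "\<dots> \<le> (\<Sum>i\<in>D \<union> {q..<d}. v i - u i)"
          unfolding blk[symmetric] by (intro sum_mono2) (use finD in auto)
        also have "\<dots> = (\<Sum>i\<in>D. v i - u i)"
          by (rule sum.mono_neutral_right) (use finD outside in auto)
        finally show ?thesis .
      next
        case False
        then have jd: "j \<notin> {q..<d}" using flat[of j] by auto
        have "(d - q) * (v j - u j) \<le> (d - q) * (g + u q)"
          using vj g(2) by (intro mult_le_mono) auto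
        also have "\<dots> \<le> (d - q) * g + d * u q" by (simp add: algebra_simps)
        also have "\<dots> \<le> (d - q) * g + (v j - u j)" using g(1) False by linarith
        also have "\<dots> = (\<Sum>i\<in>insert j {q..<d}. v i - u i)" using jd blk by simp
        also have "\<dots> \<le> (\<Sum>i\<in>D \<union> {q..<d}. v i - u i)"
          by (intro sum_mono2) (use finD jD in auto)
        also have "\<dots> = (\<Sum>i\<in>D. v i - u i)"
          by (rule sum.mono_neutral_right) (use finD outside in auto)
        finally show ?thesis .
      qed
    qed
  qed
  show ?thesis
  proof (rule that[of "r 0" "r l" q])
    show "r 0 < r l" using smr l(1) by (simp add: strict_mono_def)
    show "q < d" by (rule qd)
    show "f (r 0) \<le> f (r l)" using l(2) by (simp add: u_def)
    show "h s (r 0) \<le> h s (r l)" if "s \<in> S" for s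
      using hS[OF that] by (simp add: settled_def mono_def)
    show "h s (r 0) = h s (r l)" if "s \<in> S" "\<And>n. h s n \<le> K" for s K
    proof -
      have "\<not> filterlim (\<lambda>n. h s (r n)) at_top sequentially"
        unfolding filterlim_at_top using that(2)
        by (metis eventually_sequentially le_refl not_less_eq_eq)
      then show ?thesis using hS[OF that(1)] by (metis settled_def)
    qed
  qed (use step top big in \<open>simp_all add: u_def v_def D_def\<close>)
qed

section \<open>Cones, monoids and the action of permutations\<close>

lemma cn_zero: "(\<lambda>i. 0) \<in> cn A"
  by (auto simp: cn_def intro!: exI[of _ "{}"])

lemma cn_induct [consumes 1, case_names zero add]:
  assumes "u \<in> cn A" "P (\<lambda>i. 0)"
    and "\<And>a c u. a \<in> A \<Longrightarrow> 0 \<le> c \<Longrightarrow> P u \<Longrightarrow> P (\<lambda>i. c * a i + u i)"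
  shows "P u"
proof -
  obtain F c where F: "finite F" "F \<subseteq> A" "\<And>a. a \<in> F \<Longrightarrow> 0 \<le> c a"
    and u: "u = (\<lambda>i. \<Sum>a\<in>F. c a * a i)"
    using assms(1) by (auto simp: cn_def)
  have "P (\<lambda>i. \<Sum>a\<in>F. c a * a i)"
    using F by (induction F rule: finite_induct) (auto intro: assms(2,3))
  then show ?thesis by (simp add: u)
qed

lemma cn_scale:
  assumes "u \<in> cn A" "0 \<le> c"
  shows "(\<lambda>i. c * u i) \<in> cn A"
proof -
  obtain F e where F: "finite F" "F \<subseteq> A" "\<And>a. a \<in> F \<Longrightarrow> 0 \<le> e a"
    and u: "u = (\<lambda>i. \<Sum>a\<in>F. e a * a i)"
    using assms(1) by (auto simp: cn_def)
  show ?thesis unfolding cn_def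
    by (rule CollectI, rule exI[of _ F], rule exI[of _ "\<lambda>a. c * e a"])
      (use F assms(2) in \<open>auto simp: u sum_distrib_left mult.assoc\<close>)
qed

lemma cn_base: "a \<in> A \<Longrightarrow> a \<in> cn A"
  unfolding cn_def by (rule CollectI, rule exI[of _ "{a}"], rule exI[of _ "\<lambda>_. 1"]) auto

lemma cn_add:
  assumes "u \<in> cn A" "v \<in> cn A"
  shows "(\<lambda>i. u i + v i) \<in> cn A"
proof -
  obtain F c where F: "finite F" "F \<subseteq> A" "\<And>a. a \<in> F \<Longrightarrow> 0 \<le> c a"
    and u: "u = (\<lambda>i. \<Sum>a\<in>F. c a * a i)"
    using assms(1) by (auto simp: cn_def)
  obtain E e where E: "finite E" "E \<subseteq> A" "\<And>a. a \<in> E \<Longrightarrow> 0 \<le> e a"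
    and v: "v = (\<lambda>i. \<Sum>a\<in>E. e a * a i)"
    using assms(2) by (auto simp: cn_def)
  define c' where "c' a = (if a \<in> F then c a else 0)" for a
  define e' where "e' a = (if a \<in> E then e a else 0)" for a
  have "u i = (\<Sum>a\<in>F \<union> E. c' a * a i)" for i
    unfolding u by (rule sum.mono_neutral_cong_left) (use F E in \<open>auto simp: c'_def\<close>)
  moreover have "v i = (\<Sum>a\<in>F \<union> E. e' a * a i)" for i
    unfolding v by (rule sum.mono_neutral_cong_left) (use F E in \<open>auto simp: e'_def\<close>)
  ultimately have "(\<lambda>i. u i + v i) = (\<lambda>i. \<Sum>a\<in>F \<union> E. (c' a + e' a) * a i)"
    by (simp add: sum.distrib distrib_right)
  then show ?thesis unfolding cn_def
    by (intro CollectI exI[of _ "F \<union> E"] exI[of _ "\<lambda>a. c' a + e' a"])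
      (use F E in \<open>auto simp: c'_def e'_def\<close>)
qed

lemma mn_zero: "(\<lambda>i. 0) \<in> mn A"
  by (auto simp: mn_def intro!: exI[of _ "{}"])

lemma mn_base: "a \<in> A \<Longrightarrow> a \<in> mn A"
  unfolding mn_def by (rule CollectI, rule exI[of _ "{a}"], rule exI[of _ "\<lambda>_. 1"]) auto

lemma mn_add:
  assumes "u \<in> mn A" "v \<in> mn A"
  shows "(\<lambda>i. u i + v i) \<in> mn A"
proof -
  obtain F c where F: "finite F" "F \<subseteq> A" and u: "u = (\<lambda>i. \<Sum>a\<in>F. of_nat (c a) * a i)"
    using assms(1) by (auto simp: mn_def)
  obtain E e where E: "finite E" "E \<subseteq> A" and v: "v = (\<lambda>i. \<Sum>a\<in>E. of_nat (e a) * a i)"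
    using assms(2) by (auto simp: mn_def)
  define c' where "c' a = (if a \<in> F then c a else 0)" for a
  define e' where "e' a = (if a \<in> E then e a else 0)" for a
  have "u i = (\<Sum>a\<in>F \<union> E. of_nat (c' a) * a i)" for i
    unfolding u by (rule sum.mono_neutral_cong_left) (use F E in \<open>auto simp: c'_def\<close>)
  moreover have "v i = (\<Sum>a\<in>F \<union> E. of_nat (e' a) * a i)" for i
    unfolding v by (rule sum.mono_neutral_cong_left) (use F E in \<open>auto simp: e'_def\<close>)
  ultimately have "(\<lambda>i. u i + v i) = (\<lambda>i. \<Sum>a\<in>F \<union> E. of_nat (c' a + e' a) * a i)"
    by (simp add: sum.distrib distrib_right)
  then show ?thesis unfolding mn_def
    by (intro CollectI exI[of _ "F \<union> E"] exI[of _ "\<lambda>a. c' a + e' a"]) (use F E in auto)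
qed

lemma mn_subset:
  assumes "A \<subseteq> M" "(\<lambda>i. 0) \<in> M" "\<And>u v. u \<in> M \<Longrightarrow> v \<in> M \<Longrightarrow> (\<lambda>i. u i + v i) \<in> M"
  shows "mn A \<subseteq> M"
proof
  fix u assume "u \<in> mn A"
  then obtain F c where F: "finite F" "F \<subseteq> A" and u: "u = (\<lambda>i. \<Sum>a\<in>F. of_nat (c a) * a i)"
    by (auto simp: mn_def)
  have mult: "(\<lambda>i. of_nat n * a i) \<in> M" if "a \<in> A" for n a
  proof (induction n)
    case (Suc n)
    then show ?case using assms(3)[of a "\<lambda>i. of_nat n * a i"] assms(1) that
      by (auto simp: distrib_right)
  qed (simp add: assms(2))
  have "(\<lambda>i. \<Sum>a\<in>F. of_nat (c a) * a i) \<in> M"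
    using F by (induction F rule: finite_induct) (auto intro: assms(2) assms(3)[OF mult])
  then show "u \<in> M" by (simp add: u)
qed

section \<open>Permutations acting on sequences\<close>

lemma perm_act_mult: "perm_act \<sigma> (perm_act \<tau> u) = perm_act (\<sigma> * \<tau>) u"
  by (simp add: perm_act_def apply_times)

lemma perm_act_one [simp]: "perm_act 1 u = u"
  by (simp add: perm_act_def)

lemma perm_act_inverse [simp]:
  "perm_act (inverse \<sigma>) (perm_act \<sigma> u) = u" "perm_act \<sigma> (perm_act (inverse \<sigma>) u) = u"
  by (simp_all add: perm_act_mult)

lemma inj_apply: "inj (Perm.apply \<sigma>)"
  by (rule bij_is_inj[OF bij_apply])

lemma sum_perm_act:
  "sum (perm_act \<sigma> u) I = sum u (Perm.apply (inverse \<sigma>) ` I)"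
  unfolding perm_act_def
  by (simp add: sum.reindex inj_on_subset[OF inj_apply])

lemma supp_perm_act: "{i. u i \<noteq> 0} = Perm.apply (inverse \<sigma>) ` {i. perm_act \<sigma> u i \<noteq> 0}"
proof -
  have "surj (Perm.apply (inverse \<sigma>))" by (rule bij_is_surj[OF bij_apply])
  from surj_image_vimage_eq[OF this, of "{i. u i \<noteq> 0}"] show ?thesis
    by (simp add: perm_act_def vimage_def)
qed

lemma perm_act_R_inf [simp]: "perm_act \<sigma> u \<in> R_inf \<longleftrightarrow> u \<in> R_inf"
  unfolding R_inf_def mem_Collect_eq supp_perm_act[of u \<sigma>]
  by (rule finite_image_iff[symmetric]) (rule inj_on_subset[OF inj_apply], simp)

lemma perm_act_Z_inf: "u \<in> Z_inf \<Longrightarrow> perm_act \<sigma> u \<in> Z_inf"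
  by (simp add: Z_inf_def Z_seq_def) (simp add: perm_act_def)

section \<open>Sums of all entries\<close>

definition mass :: "(nat \<Rightarrow> real) \<Rightarrow> real" where
  "mass u = sum u {i. u i \<noteq> 0}"

lemma mass_eq:
  assumes "finite F" "{i. u i \<noteq> 0} \<subseteq> F"
  shows "mass u = sum u F"
  unfolding mass_def by (rule sum.mono_neutral_left) (use assms in auto)

lemma mass_lessThan: "(\<And>i. i \<ge> N \<Longrightarrow> u i = 0) \<Longrightarrow> mass u = sum u {..<N}"
  by (rule mass_eq) (auto simp: not_le[symmetric])

lemma R_inf_bound:
  assumes "u \<in> R_inf"
  obtains N where "\<And>i. i \<ge> N \<Longrightarrow> u i = 0"
proof -
  obtain N where "\<And>i. u i \<noteq> 0 \<Longrightarrow> i < N"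
    using assms by (auto simp: R_inf_def finite_nat_set_iff_bounded)
  then show thesis using that[of N] by (meson not_le)
qed

lemma R_infI:
  assumes "\<And>i. i \<ge> N \<Longrightarrow> u i = 0"
  shows "u \<in> R_inf"
proof -
  have "{i. u i \<noteq> 0} \<subseteq> {..<N}" using assms by (auto simp: not_le[symmetric])
  then show ?thesis by (auto simp: R_inf_def intro: finite_subset)
qed

lemma R_inf_lincomb:
  assumes "u \<in> R_inf" "v \<in> R_inf"
  shows "(\<lambda>i. c * u i + e * v i) \<in> R_inf"
    "mass (\<lambda>i. c * u i + e * v i) = c * mass u + e * mass v"
proof -
  obtain M where M: "\<And>i. i \<ge> M \<Longrightarrow> u i = 0" using R_inf_bound[OF assms(1)] by blast
  obtain N where N: "\<And>i. i \<ge> N \<Longrightarrow> v i = 0" using R_inf_bound[OF assms(2)] by blast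
  show "(\<lambda>i. c * u i + e * v i) \<in> R_inf"
    by (rule R_infI[of "max M N"]) (simp add: M N)
  show "mass (\<lambda>i. c * u i + e * v i) = c * mass u + e * mass v"
    using mass_lessThan[of "max M N" u] mass_lessThan[of "max M N" v]
      mass_lessThan[of "max M N" "\<lambda>i. c * u i + e * v i"]
    by (simp add: M N sum.distrib sum_distrib_left)
qed

lemma R_inf_add:
  assumes "u \<in> R_inf" "v \<in> R_inf"
  shows "(\<lambda>i. u i + v i) \<in> R_inf" "mass (\<lambda>i. u i + v i) = mass u + mass v"
  using R_inf_lincomb[OF assms, of 1 1] by simp_all

lemma R_inf_scale:
  assumes "u \<in> R_inf"
  shows "(\<lambda>i. c * u i) \<in> R_inf" "mass (\<lambda>i. c * u i) = c * mass u"
  using R_inf_lincomb[OF assms assms, of c 0] by simp_all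

lemma zero_R_inf: "(\<lambda>i. 0) \<in> R_inf" "mass (\<lambda>i. 0) = 0"
  by (auto simp: R_inf_def mass_def)

lemma mass_perm_act: "mass (perm_act \<sigma> u) = mass u"
  unfolding mass_def sum_perm_act supp_perm_act[of u \<sigma>] ..

lemma sum_le_mass:
  assumes "u \<in> R_inf" "\<And>i. 0 \<le> u i" "finite I"
  shows "sum u I \<le> mass u"
proof -
  have "mass u = sum u ({i. u i \<noteq> 0} \<union> I)"
    by (rule mass_eq) (use assms in \<open>auto simp: R_inf_def\<close>)
  moreover have "sum u I \<le> sum u ({i. u i \<noteq> 0} \<union> I)"
    by (rule sum_mono2) (use assms in \<open>auto simp: R_inf_def\<close>)
  ultimately show ?thesis by simp
qed

lemma mass_pos:
  assumes "u \<in> R_inf" "\<And>i. 0 \<le> u i" "u \<noteq> (\<lambda>i. 0)"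
  shows "0 < mass u"
  unfolding mass_def using assms
  by (intro sum_pos) (auto simp: R_inf_def less_le fun_eq_iff)

lemma mass_int:
  assumes "u \<in> Z_inf"
  shows "mass u \<in> \<int>"
  using assms by (auto simp: mass_def Z_inf_def Z_seq_def)

section \<open>Majorization\<close>

text \<open>Isolates the closure properties on which majorization rests: a convex cone stable under
  permutations.\<close>

definition sym_cone :: "(nat \<Rightarrow> real) set \<Rightarrow> bool" where
  "sym_cone C \<longleftrightarrow> (\<lambda>i. 0) \<in> C \<and> (\<forall>u\<in>C. \<forall>v\<in>C. (\<lambda>i. u i + v i) \<in> C) \<and>
     (\<forall>u\<in>C. \<forall>c\<ge>0. (\<lambda>i. c * u i) \<in> C) \<and> (\<forall>u\<in>C. \<forall>\<sigma>. perm_act \<sigma> u \<in> C)"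

lemma sym_coneD:
  assumes "sym_cone C"
  shows "(\<lambda>i. 0) \<in> C" "u \<in> C \<Longrightarrow> v \<in> C \<Longrightarrow> (\<lambda>i. u i + v i) \<in> C"
    "u \<in> C \<Longrightarrow> 0 \<le> c \<Longrightarrow> (\<lambda>i. c * u i) \<in> C" "u \<in> C \<Longrightarrow> perm_act \<sigma> u \<in> C"
  using assms by (auto simp: sym_cone_def)

lemma sym_cone_cn_Sym: "sym_cone (cn (Sym A))"
proof -
  have "perm_act \<sigma> u \<in> cn (Sym A)" if "u \<in> cn (Sym A)" for u \<sigma>
    using that
  proof (induction rule: cn_induct)
    case zero
    then show ?case by (simp add: perm_act_def cn_zero)
  next
    case (add a c u)
    from add(1) obtain \<tau> b where "a = perm_act \<tau> b" "b \<in> A" by (auto simp: Sym_def)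
    then have "perm_act \<sigma> a \<in> Sym A" unfolding Sym_def perm_act_mult[symmetric]
      using perm_act_mult by blast
    then have "(\<lambda>i. c * perm_act \<sigma> a i + perm_act \<sigma> u i) \<in> cn (Sym A)"
      using add by (intro cn_add cn_scale) (auto intro: cn_base)
    then show ?case by (simp add: perm_act_def)
  qed
  then show ?thesis by (auto simp: sym_cone_def intro: cn_zero cn_add cn_scale)
qed

lemma sym_cone_sum:
  assumes "sym_cone C" "finite A" "A \<subseteq> C" "\<And>a. a \<in> A \<Longrightarrow> 0 \<le> c a"
  shows "(\<lambda>i. \<Sum>a\<in>A. c a * a i) \<in> C"
  using assms(2-)
proof (induction A rule: finite_induct)
  case empty
  then show ?case by (simp add: sym_coneD[OF assms(1)])
next
  case (insert a A)
  then have "(\<lambda>i. c a * a i + (\<Sum>a\<in>A. c a * a i)) \<in> C"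
    by (intro sym_coneD[OF assms(1)]) auto
  then show ?case using insert by simp
qed

text \<open>The new vector is a convex combination of \<open>x\<close> and its image under the
  transposition of \<open>k\<close> and \<open>l\<close>; the image has weight
  \<open>t / (x k - x l)\<close>.\<close>

lemma sym_cone_transfer:
  assumes "sym_cone C" "x \<in> C" "0 \<le> t" "t \<le> x k - x l" "k \<noteq> l"
  shows "x(k := x k - t, l := x l + t) \<in> C"
proof (cases "x k = x l")
  case True
  then have "x(k := x k - t, l := x l + t) = x" using assms by (auto simp: fun_eq_iff)
  then show ?thesis using assms(2) by metis
next
  case False
  define \<theta> where "\<theta> = t / (x k - x l)"
  have \<theta>: "0 \<le> \<theta>" "\<theta> \<le> 1" "\<theta> * (x k - x l) = t"
    using assms False by (auto simp: \<theta>_def divide_simps)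
  let ?s = "Perm.swap k l"
  have "(\<lambda>i. (1 - \<theta>) * x i + \<theta> * perm_act ?s x i) \<in> C"
    using assms(1,2) \<theta> by (intro sym_coneD) auto
  moreover have "(\<lambda>i. (1 - \<theta>) * x i + \<theta> * perm_act ?s x i) = x(k := x k - t, l := x l + t)"
  proof
    fix i
    consider "i = k" | "i = l" | "i \<noteq> k" "i \<noteq> l" by blast
    then show "(1 - \<theta>) * x i + \<theta> * perm_act ?s x i = (x(k := x k - t, l := x l + t)) i"
      by cases (use assms(5) \<theta>(3) in \<open>auto simp: perm_act_def algebra_simps\<close>)
  qed
  ultimately show ?thesis by simp
qed

text \<open>Hardy, Littlewood and Polya: a vector majorized by \<open>x\<close> is reached from \<open>x\<close> by transfers from a
  larger to a smaller entry, each of which makes one more entry agree. It is essential that the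
  receiving position \<open>l\<close> is the first one with a deficit; \<open>x\<close> need not be sorted.\<close>
lemma majorized_mem:
  assumes "sym_cone C" "antimono u"
    and "\<And>i. i \<ge> N \<Longrightarrow> u i = 0"
    and "x \<in> C" "\<And>i. i \<ge> N \<Longrightarrow> x i = 0"
    and "\<And>k. sum u {..<k} \<le> sum x {..<k}" "sum u {..<N} = sum x {..<N}"
  shows "u \<in> C"
  using assms(4-)
proof (induction "card {i. u i \<noteq> x i}" arbitrary: x rule: less_induct)
  case less
  have fin: "finite {i. u i \<noteq> x i}"
    by (rule finite_subset[of _ "{..<N}"])
      (use less.prems(2) assms(3) in \<open>auto simp: not_le[symmetric]\<close>)
  show ?case
  proof (cases "u = x")
    case True
    then show ?thesis using less.prems(1) by simp
  next
    case False
    \<comment> \<open>Without a deficit \<open>u\<close> lies below \<open>x\<close> everywhere, and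
      equal totals would force \<open>u = x\<close>.\<close>
    have ex: "\<exists>l. x l < u l"
    proof (rule ccontr)
      assume "\<not> ?thesis"
      then have le: "u i \<le> x i" for i by (meson not_le)
      have "u i = x i" if "i < N" for i
      proof (rule ccontr)
        assume "u i \<noteq> x i"
        then have "sum u {..<N} < sum x {..<N}"
          using le that by (intro sum_strict_mono_ex1) (auto intro!: bexI[of _ i] simp: less_le)
        then show False using less.prems(4) by simp
      qed
      then show False using False less.prems(2) assms(3) by (metis ext not_le)
    qed
    define l where "l = (LEAST l. x l < u l)"
    have l: "x l < u l" using LeastI_ex[OF ex] by (simp add: l_def)
    have before: "u i \<le> x i" if "i < l" for i
      using not_less_Least[of i "\<lambda>l. x l < u l"] that by (simp add: l_def)
    \<comment> \<open>With no surplus before \<open>l\<close>, the deficit at \<open>l\<close> would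
      violate the partial sum bound for \<open>Suc l\<close>.\<close>
    have "\<exists>k<l. u k < x k"
    proof (rule ccontr)
      assume "\<not> ?thesis"
      then have "x i \<le> u i" if "i < l" for i using that by (meson not_le)
      then have "sum x {..<l} \<le> sum u {..<l}" by (intro sum_mono) simp
      then show False using less.prems(3)[of "Suc l"] l by simp
    qed
    then obtain k where k: "k < l" "u k < x k" by blast
    \<comment> \<open>The largest amount that overshoots at neither position; at least one of the
      two entries reaches its target.\<close>
    define t where "t = min (x k - u k) (u l - x l)"
    have t: "0 < t" "t \<le> x k - u k" "t \<le> u l - x l" using k l by (auto simp: t_def)
    have "u l \<le> u k" using assms(2) k(1) by (auto simp: antimono_def)
    define x' where "x' = x(k := x k - t, l := x l + t)"
    have kN: "l < N" using l assms(3)[of l] less.prems(2)[of l] by (cases "l < N") auto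
    have "x' \<in> C" unfolding x'_def
      using \<open>u l \<le> u k\<close> t l k by (intro sym_cone_transfer assms(1) less.prems(1)) auto
    moreover have "x' i = 0" if "i \<ge> N" for i
      using that kN k less.prems(2)[of i] by (auto simp: x'_def)
    moreover have sum_x': "sum x' {..<j} = sum x {..<j} + (if l < j then t else 0) - (if k < j then t else 0)" for j
    proof -
      have "x' = (\<lambda>i. x i + (if l = i then t else 0) - (if k = i then t else 0))"
        using k by (auto simp: x'_def fun_eq_iff)
      then show ?thesis by (simp add: sum.distrib sum_subtractf)
    qed
    have "sum u {..<j} \<le> sum x' {..<j}" for j
    \<comment> \<open>Only prefixes containing \<open>k\<close> but not \<open>l\<close> lose
      \<open>t\<close>. As \<open>l\<close> is the first deficit, all their terms
      \<open>x i - u i\<close> are nonnegative, and the one at \<open>k\<close> alone is at least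
      \<open>t\<close>.\<close>
    proof (cases "k < j \<and> j \<le> l")
      case True
      then have "t \<le> x k - u k" using t by simp
      also have "\<dots> = (\<Sum>i\<in>{k}. x i - u i)" by simp
      also have "\<dots> \<le> (\<Sum>i<j. x i - u i)"
        by (rule sum_mono2) (use True before in auto)
      finally show ?thesis using sum_x'[of j] True by (simp add: sum_subtractf)
    next
      case False
      then show ?thesis using sum_x'[of j] less.prems(3)[of j] k by auto
    qed
    moreover have "sum u {..<N} = sum x' {..<N}"
      using sum_x'[of N] kN k less.prems(4) by simp
    moreover have "card {i. u i \<noteq> x' i} < card {i. u i \<noteq> x i}"
    proof (rule psubset_card_mono[OF fin])
      have other: "x' i = x i" if "i \<noteq> k" "i \<noteq> l" for i using that by (simp add: x'_def)
      have "u k = x' k \<and> u k \<noteq> x k \<or> u l = x' l \<and> u l \<noteq> x l"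
        using k l by (auto simp: x'_def t_def min_def)
      then obtain p where p: "u p = x' p" "u p \<noteq> x p" by blast
      have "u i \<noteq> x i" if "u i \<noteq> x' i" for i
        using that other[of i] k(2) l by (cases "i = k"; cases "i = l") auto
      then show "{i. u i \<noteq> x' i} \<subset> {i. u i \<noteq> x i}" using p by blast
    qed
    ultimately show ?thesis using less.hyps[of x'] by blast
  qed
qed

section \<open>Decreasing rearrangements\<close>

lemma ex_sort_prefix:
  "\<exists>\<sigma>. (\<forall>i\<ge>N. Perm.apply \<sigma> i = i) \<and> (\<forall>i j. i \<le> j \<longrightarrow> j < N \<longrightarrow> perm_act \<sigma> u j \<le> perm_act \<sigma> u i)"
proof (induction N arbitrary: u)
  case 0
  show ?case by (intro exI[of _ 1]) simp
next
  case (Suc N)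
  \<comment> \<open>Selection sort: the smallest of the first \<open>Suc N\<close> entries moves to
    position \<open>N\<close>, and the induction hypothesis sorts the rest.\<close>
  have "\<exists>m\<in>{..N}. \<forall>i\<in>{..N}. u m \<le> u i"
    using arg_min_if_finite[of "{..N}" u] by (metis (no_types, lifting) atMost_iff empty_iff finite_atMost le0 not_le)
  then obtain m where m: "m \<le> N" "\<And>i. i \<le> N \<Longrightarrow> u m \<le> u i" by auto
  define w where "w = perm_act (Perm.swap m N) u"
  obtain \<sigma> where \<sigma>: "\<And>i. i \<ge> N \<Longrightarrow> Perm.apply \<sigma> i = i"
    "\<And>i j. i \<le> j \<Longrightarrow> j < N \<Longrightarrow> perm_act \<sigma> w j \<le> perm_act \<sigma> w i"
    using Suc.IH[of w] by blast
  have inv_fix: "Perm.apply (inverse \<sigma>) i = i" if "i \<ge> N" for i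
    using \<sigma>(1)[OF that] by (metis affected_inverse in_affected)
  have inv_less: "Perm.apply (inverse \<sigma>) i < N" if "i < N" for i
    using inv_fix[of "Perm.apply (inverse \<sigma>) i"] that by (metis apply_inj not_le)
  have wN: "w N = u m" by (simp add: w_def perm_act_def)
  have w_ge: "u m \<le> w i" if "i \<le> N" for i
    unfolding w_def perm_act_def inverse_swap
    by (intro m(2)) (metis apply_swap_same apply_swap_simp m(1) le_refl that)
  show ?case
  proof (intro exI[of _ "\<sigma> * Perm.swap m N"] conjI allI impI)
    fix i assume "Suc N \<le> i"
    then show "Perm.apply (\<sigma> * Perm.swap m N) i = i"
      using m(1) \<sigma>(1)[of i] by (simp add: apply_times)
  next
    fix i j assume ij: "i \<le> j" "j < Suc N"
    have "perm_act \<sigma> w j \<le> perm_act \<sigma> w i"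
    proof (cases "j < N")
      case True
      then show ?thesis using \<sigma>(2) ij by blast
    next
      case False
      then have "j = N" using ij by simp
      then have "perm_act \<sigma> w j = u m" using inv_fix[of N] wN by (simp add: perm_act_def)
      moreover have "Perm.apply (inverse \<sigma>) i \<le> N"
        using inv_less[of i] inv_fix[of i] ij \<open>j = N\<close> by (cases "i < N") auto
      ultimately show ?thesis using w_ge by (simp add: perm_act_def)
    qed
    then show "perm_act (\<sigma> * Perm.swap m N) u j \<le> perm_act (\<sigma> * Perm.swap m N) u i"
      by (simp add: w_def perm_act_mult)
  qed
qed

lemma ex_sort:
  assumes "u \<in> R_inf_nonneg"
  shows "\<exists>\<sigma>. antimono (perm_act \<sigma> u)"
proof -
  obtain N where N: "\<And>i. i \<ge> N \<Longrightarrow> u i = 0"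
    using assms R_inf_bound unfolding R_inf_nonneg_def by blast
  obtain \<sigma> where \<sigma>: "\<And>i. i \<ge> N \<Longrightarrow> Perm.apply \<sigma> i = i"
    "\<And>i j. i \<le> j \<Longrightarrow> j < N \<Longrightarrow> perm_act \<sigma> u j \<le> perm_act \<sigma> u i"
    using ex_sort_prefix[of N u] by blast
  have "perm_act \<sigma> u j \<le> perm_act \<sigma> u i" if "i \<le> j" for i j
  proof (cases "j < N")
    case True
    then show ?thesis using \<sigma>(2) that by blast
  next
    case False
    then have "Perm.apply (inverse \<sigma>) j = j"
      using \<sigma>(1)[of j] by (metis affected_inverse in_affected not_le)
    then have "perm_act \<sigma> u j = 0" using N[of j] False by (simp add: perm_act_def)
    then show ?thesis using assms by (simp add: R_inf_nonneg_def perm_act_def)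
  qed
  then show ?thesis by (auto simp: antimono_def)
qed

text \<open>Counted from 0, the \<open>k\<close>-th smallest index in \<open>I\<close> is at least
  \<open>k\<close>, so every term can be moved forward; the induction removes the largest
  index.\<close>

lemma antimono_sum_le:
  fixes z :: "nat \<Rightarrow> real"
  assumes "antimono z" "finite I"
  shows "sum z I \<le> sum z {..<card I}"
  using assms(2)
proof (induction I rule: finite_linorder_max_induct)
  case (insert b A)
  have "card A \<le> b" using card_mono[of "{..<b}" A] insert by auto
  then have "z b \<le> z (card A)" using assms(1) by (auto simp: antimono_def)
  moreover have "b \<notin> A" using insert by auto
  ultimately show ?case using insert by simp
qed simp

text \<open>Reduces to \<open>majorized_mem\<close> for the decreasing rearrangement of
  \<open>y\<close>, whose prefix sums are sums of \<open>y\<close> over finite sets; the inverse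
  permutation carries membership back.\<close>

lemma subset_sums_mem:
  assumes C: "sym_cone C" and y: "y \<in> R_inf_nonneg" and x: "x \<in> C" "x \<in> R_inf"
    and le: "\<And>I. finite I \<Longrightarrow> sum y I \<le> sum x {..<card I}" and tot: "mass y = mass x"
  shows "y \<in> C"
proof -
  obtain \<sigma> where \<sigma>: "antimono (perm_act \<sigma> y)" using ex_sort[OF y] by blast
  define w where "w = perm_act \<sigma> y"
  have "w \<in> R_inf" using y by (simp add: w_def R_inf_nonneg_def)
  then obtain M where M: "\<And>i. i \<ge> M \<Longrightarrow> w i = 0" using R_inf_bound by blast
  obtain N where N: "\<And>i. i \<ge> N \<Longrightarrow> x i = 0" using R_inf_bound[OF x(2)] by blast
  have "w \<in> C"
  proof (rule majorized_mem[OF C, where N = "max M N"])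
    show "antimono w" using \<sigma> by (simp add: w_def)
    show "sum w {..<k} \<le> sum x {..<k}" for k
      unfolding w_def sum_perm_act
      using le[of "Perm.apply (inverse \<sigma>) ` {..<k}"]
      by (simp add: card_image inj_on_subset[OF inj_apply])
    show "sum w {..<max M N} = sum x {..<max M N}"
      using tot mass_lessThan[of "max M N" w] mass_lessThan[of "max M N" x] M N
      by (simp add: w_def mass_perm_act)
  qed (use x M N in auto)
  then have "perm_act (inverse \<sigma>) w \<in> C" using sym_coneD(4)[OF C] by blast
  then show ?thesis by (simp add: w_def)
qed

text \<open>With denominators cleared, this is concavity of the partial sums between
  \<open>q\<close> and \<open>d\<close>: \<open>x k\<close> is at most each entry before it and at
  least each entry after it.\<close>

lemma antimono_sum_concave:
  fixes x :: "nat \<Rightarrow> real"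
  assumes "antimono x" "q \<le> k" "k \<le> d"
  shows "real (k - q) * (sum x {..<d} - sum x {..<q}) \<le> real (d - q) * (sum x {..<k} - sum x {..<q})"
proof -
  have e: "sum x {..<k} = sum x {..<q} + sum x {q..<k}"
    "sum x {..<d} = sum x {..<q} + sum x {q..<k} + sum x {k..<d}"
    using assms by (simp_all add: lessThan_atLeast0 sum.atLeastLessThan_concat)
  have a: "real (k - q) * x k \<le> sum x {q..<k}"
    using sum_bounded_below[of "{q..<k}" "x k" x] assms(1) by (simp add: antimono_def)
  have b: "sum x {k..<d} \<le> real (d - k) * x k"
    using sum_bounded_above[of "{k..<d}" x "x k"] assms(1) by (simp add: antimono_def)
  have "real (k - q) * sum x {k..<d} \<le> real (k - q) * (real (d - k) * x k)"
    using b by (rule mult_left_mono) simp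
  also have "\<dots> = real (d - k) * (real (k - q) * x k)" by simp
  also have "\<dots> \<le> real (d - k) * sum x {q..<k}" using a by (rule mult_left_mono) simp
  finally have "real (k - q) * sum x {k..<d} \<le> real (d - k) * sum x {q..<k}" .
  then show ?thesis using assms by (simp add: e of_nat_diff algebra_simps)
qed

text \<open>Replacing all entries from \<open>q\<close> on by their maximum \<open>\<mu>\<close>
  gives a decreasing \<open>z\<close> above \<open>y\<close>, so prefix sums of \<open>z\<close>
  suffice. Between \<open>q\<close> and \<open>d\<close> these are linear, hence stay below the
  concave partial sums of \<open>x\<close> once they do so at both ends: \<open>pre\<close> gives
  the end \<open>q\<close>, \<open>tail\<close> with \<open>tot\<close> the end \<open>d\<close>.
  From \<open>d\<close> on, the partial sums of \<open>x\<close> equal the total of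
  \<open>y\<close>.\<close>

lemma subset_sums_le:
  fixes x y :: "nat \<Rightarrow> real"
  assumes x: "antimono x" "\<And>i. i \<ge> d \<Longrightarrow> x i = 0" and y: "y \<in> R_inf_nonneg" and "q < d"
    and tot: "mass y = sum x {..<d}"
    and pre: "\<And>k. k \<le> q \<Longrightarrow> sum y {..<k} \<le> sum x {..<k}"
    and anti: "\<And>i. Suc i < d \<Longrightarrow> y (Suc i) \<le> y i"
    and top: "\<And>i j. i < q \<Longrightarrow> q \<le> j \<Longrightarrow> y j \<le> y i"
    and tail: "\<And>j. q \<le> j \<Longrightarrow> real (d - q) * y j \<le> mass y - sum y {..<q}"
    and "finite I"
  shows "sum y I \<le> sum x {..<card I}"
proof -
  have y0: "y \<in> R_inf" "\<And>i. 0 \<le> y i" using y by (auto simp: R_inf_nonneg_def)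
  obtain N where N: "\<And>i. i \<ge> N \<Longrightarrow> y i = 0" using R_inf_bound[OF y0(1)] by blast
  \<comment> \<open>The range is nonempty and includes every position from \<open>q\<close> on with
    a nonzero entry.\<close>
  define \<mu> where "\<mu> = Max (y ` {q..q + N})"
  have "\<mu> \<in> y ` {q..q + N}" unfolding \<mu>_def by (rule Max_in) auto
  then obtain m where m: "m \<ge> q" "\<mu> = y m" by auto
  have \<mu>: "y j \<le> \<mu>" if "q \<le> j" for j
  proof (cases "j \<le> q + N")
    case True
    then show ?thesis using that by (auto simp: \<mu>_def intro!: Max_ge)
  qed (use N[of j] y0(2)[of m] m in simp)
  define z where "z i = (if i < q then y i else \<mu>)" for i
  have desc: "y j \<le> y i" if "i \<le> j" "j < q" for i j
    using that
  proof (induction j rule: dec_induct)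
    case (step n)
    then show ?case using anti[of n] \<open>q < d\<close> by simp
  qed simp
  have "antimono z"
    using desc top[OF _ m(1)] m(2) by (auto simp: antimono_def z_def)
  have "sum y I \<le> sum z I" by (rule sum_mono) (use \<mu> in \<open>auto simp: z_def\<close>)
  also have "\<dots> \<le> sum z {..<card I}" by (rule antimono_sum_le) fact+
  finally have yz: "sum y I \<le> sum z {..<card I}" .
  consider "card I \<le> q" | "q < card I" "card I < d" | "d \<le> card I" by linarith
  then show ?thesis
  proof cases
    case 1
    then have "sum z {..<card I} = sum y {..<card I}" by (intro sum.cong) (auto simp: z_def)
    then show ?thesis using yz pre[OF 1] by simp
  next
    case 2
    define k where "k = card I"
    have "{..<k} = {..<q} \<union> {q..<k}" using 2 by (auto simp: k_def)
    then have "sum z {..<k} = sum z {..<q} + sum z {q..<k}"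
      by (simp add: sum.union_disjoint ivl_disj_int)
    also have "\<dots> = sum y {..<q} + real (k - q) * \<mu>" by (simp add: z_def)
    finally have zk: "sum z {..<k} = sum y {..<q} + real (k - q) * \<mu>" .
    \<comment> \<open>Linear interpolation between the ends \<open>q\<close> and \<open>d\<close>,
      multiplied by \<open>d - q\<close>.\<close>
    have "real (d - q) * sum z {..<k} = real (d - q) * sum y {..<q} + real (k - q) * (real (d - q) * \<mu>)"
      by (simp add: zk algebra_simps)
    also have "\<dots> \<le> real (d - q) * sum y {..<q} + real (k - q) * (mass y - sum y {..<q})"
      using tail[OF m(1)] m(2) by (intro add_left_mono mult_left_mono) auto
    also have "\<dots> = real (d - k) * sum y {..<q} + real (k - q) * mass y"
      using 2 \<open>q < d\<close> by (simp add: k_def of_nat_diff algebra_simps)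
    also have "\<dots> \<le> real (d - k) * sum x {..<q} + real (k - q) * sum x {..<d}"
      unfolding tot using pre[of q] by (intro add_right_mono mult_left_mono) auto
    also have "\<dots> = real (k - q) * (sum x {..<d} - sum x {..<q}) + real (d - q) * sum x {..<q}"
      using 2 \<open>q < d\<close> by (simp add: k_def of_nat_diff algebra_simps)
    also have "\<dots> \<le> real (d - q) * sum x {..<k}"
      using antimono_sum_concave[OF x(1), of q k d] 2 by (simp add: k_def algebra_simps)
    finally have "sum z {..<k} \<le> sum x {..<k}" using \<open>q < d\<close> by simp
    then show ?thesis using yz by (simp add: k_def)
  next
    case 3
    have "sum y I \<le> mass y" using y0 \<open>finite I\<close> by (rule sum_le_mass)
    also have "\<dots> = sum x {..<card I}"
      unfolding tot by (rule sum.mono_neutral_left) (use 3 x(2) in auto)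
    finally show ?thesis .
  qed
qed

section \<open>Irreducible elements\<close>

definition dominated :: "(nat \<Rightarrow> real) set \<Rightarrow> (nat \<Rightarrow> real) \<Rightarrow> bool" where
  "dominated A y \<longleftrightarrow> y \<in> R_inf \<and> (\<exists>c. (\<forall>a\<in>A. 0 \<le> c a) \<and>
     (\<forall>k. sum y {..<k} \<le> (\<Sum>a\<in>A. c a * sum a {..<k})) \<and> mass y = (\<Sum>a\<in>A. c a * mass a))"

lemma dominated_zero: "dominated A (\<lambda>i. 0)"
  unfolding dominated_def by (auto simp: zero_R_inf intro!: exI[of _ "\<lambda>_. 0"])

text \<open>Domination concerns the prefix sums of a vector in its given order, not of its
  decreasing rearrangement, so it is linear and the coefficients combine in the same way as the
  vectors.\<close>

lemma dominated_lincomb: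
  assumes "dominated A u" "dominated A v" "0 \<le> t"
  shows "dominated A (\<lambda>i. t * u i + v i)"
proof -
  obtain c where c: "\<forall>a\<in>A. 0 \<le> c a" "\<And>k. sum u {..<k} \<le> (\<Sum>a\<in>A. c a * sum a {..<k})"
    "mass u = (\<Sum>a\<in>A. c a * mass a)" "u \<in> R_inf"
    using assms(1) by (auto simp: dominated_def)
  obtain e where e: "\<forall>a\<in>A. 0 \<le> e a" "\<And>k. sum v {..<k} \<le> (\<Sum>a\<in>A. e a * sum a {..<k})"
    "mass v = (\<Sum>a\<in>A. e a * mass a)" "v \<in> R_inf"
    using assms(2) by (auto simp: dominated_def)
  have split: "(\<Sum>a\<in>A. (t * c a + e a) * g a) = t * (\<Sum>a\<in>A. c a * g a) + (\<Sum>a\<in>A. e a * g a)"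
    for g :: "(nat \<Rightarrow> real) \<Rightarrow> real"
    by (simp add: sum_distrib_left sum.distrib algebra_simps)
  have "(\<Sum>i<k. t * u i + v i) \<le> (\<Sum>a\<in>A. (t * c a + e a) * sum a {..<k})" for k
    unfolding split sum.distrib sum_distrib_left[symmetric]
    using c(2)[of k] e(2)[of k] assms(3) by (intro add_mono mult_left_mono) auto
  moreover have "mass (\<lambda>i. t * u i + v i) = (\<Sum>a\<in>A. (t * c a + e a) * mass a)"
    unfolding split using R_inf_lincomb(2)[OF c(4) e(4), of t 1] c(3) e(3) by simp
  moreover have "(\<lambda>i. t * u i + v i) \<in> R_inf"
    using R_inf_lincomb(1)[OF c(4) e(4), of t 1] by simp
  ultimately show ?thesis unfolding dominated_def
    using c(1) e(1) assms(3) by (intro conjI exI[of _ "\<lambda>a. t * c a + e a"]) auto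
qed

text \<open>Take coefficient 1 at \<open>a\<close> and 0 elsewhere: permuting a decreasing sequence
  cannot raise its prefix sums.\<close>

lemma dominated_perm_act:
  assumes "finite A" "a \<in> A" "antimono a" "a \<in> R_inf"
  shows "dominated A (perm_act \<tau> a)"
proof -
  have "sum (perm_act \<tau> a) {..<k} \<le> sum a {..<k}" for k
    unfolding sum_perm_act
    using antimono_sum_le[OF assms(3), of "Perm.apply (inverse \<tau>) ` {..<k}"]
    by (simp add: card_image inj_on_subset[OF inj_apply])
  moreover have "(\<Sum>b\<in>A. (if b = a then 1 else 0) * g b) = g a" for g :: "(nat \<Rightarrow> real) \<Rightarrow> real"
    using assms(1,2) by (simp add: if_distrib[of "\<lambda>x. x * _"] cong: if_cong)
  ultimately show ?thesis unfolding dominated_def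
    using assms(4) by (intro conjI exI[of _ "\<lambda>b. if b = a then 1 else 0"]) (auto simp: mass_perm_act)
qed

lemma Q_inf_common_denominator:
  assumes "g \<in> Q_inf"
  obtains n :: nat where "0 < n" "(\<lambda>i. of_nat n * g i) \<in> Z_inf"
proof -
  have den: "\<exists>n::nat. 0 < n \<and> (\<forall>i\<in>F. of_nat n * g i \<in> \<int>)" if "finite F" for F
    using that
  proof (induction F)
    case empty
    then show ?case by (auto intro: exI[of _ 1])
  next
    case (insert j F)
    then obtain n :: nat where n: "0 < n" "\<forall>i\<in>F. of_nat n * g i \<in> \<int>" by blast
    have "g j \<in> \<rat>" using assms by (simp add: Q_inf_def)
    then obtain p q :: int where pq: "0 < q" "g j = of_int p / of_int q"
      by (metis Rats_cases')
    have "of_nat (n * nat q) * g i \<in> \<int>" if "i \<in> insert j F" for i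
    proof (cases "i = j")
      case True
      have "of_nat (n * nat q) * g i = of_nat n * of_int p"
        using pq True by simp
      then show ?thesis by (metis Ints_mult Ints_of_nat Ints_of_int)
    next
      case False
      have "of_nat (n * nat q) * g i = of_nat (nat q) * (of_nat n * g i)" by simp
      moreover have "of_nat n * g i \<in> \<int>" using False that n(2) by blast
      ultimately show ?thesis by (metis Ints_mult Ints_of_nat)
    qed
    then show ?case using n(1) pq(1) by (intro exI[of _ "n * nat q"]) auto
  qed
  have gR: "g \<in> R_inf" using assms by (simp add: Q_inf_def)
  then have "finite {i. g i \<noteq> 0}" by (simp add: R_inf_def)
  from den[OF this] obtain n :: nat where n: "0 < n" "\<forall>i\<in>{i. g i \<noteq> 0}. of_nat n * g i \<in> \<int>" by blast
  have "of_nat n * g i \<in> \<int>" for i using n(2) by (cases "g i = 0") auto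
  then have "(\<lambda>i. of_nat n * g i) \<in> Z_inf"
    using R_inf_scale(1)[OF gR] by (simp add: Z_inf_def Z_seq_def)
  then show thesis using that n(1) by blast
qed

text \<open>Each of the finitely many orbit generators is a combination of finitely many rational
  generators; clearing denominators and sorting turns the latter into \<open>A\<close>. Domination
  then passes to all their permuted copies and to combinations of these.\<close>

lemma ex_dominating_generators:
  assumes C: "C \<subseteq> R_inf_nonneg" and "rational_cone C" "Sym_fg_cone C"
  obtains A where "finite A" "A \<subseteq> C \<inter> Z_inf" "\<And>a. a \<in> A \<Longrightarrow> antimono a"
    "\<And>y. y \<in> C \<Longrightarrow> dominated A y"
proof -
  obtain G where G: "G \<subseteq> Q_inf" "C = cn G" using assms(2) by (auto simp: rational_cone_def)
  obtain A0 where A0: "finite A0" "C = cn (Sym A0)" using assms(3) by (auto simp: Sym_fg_cone_def)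
  have sc: "sym_cone C" using sym_cone_cn_Sym A0(2) by simp
  have "\<exists>F. finite F \<and> F \<subseteq> G \<and> a \<in> cn F" if "a \<in> A0" for a
  proof -
    have "a \<in> Sym A0" using that unfolding Sym_def by (metis (mono_tags, lifting) mem_Collect_eq perm_act_one)
    then have "a \<in> cn G" using cn_base A0(2) G(2) by blast
    then obtain F c where "finite F" "F \<subseteq> G" "\<forall>a\<in>F. 0 \<le> c a" "a = (\<lambda>i. \<Sum>a\<in>F. c a * a i)"
      by (auto simp: cn_def)
    then show ?thesis unfolding cn_def by blast
  qed
  then obtain F where F: "\<And>a. a \<in> A0 \<Longrightarrow> finite (F a)" "\<And>a. a \<in> A0 \<Longrightarrow> F a \<subseteq> G"
    "\<And>a. a \<in> A0 \<Longrightarrow> a \<in> cn (F a)" by metis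
  define H where "H = (\<Union>a\<in>A0. F a)"
  have H: "finite H" "H \<subseteq> G" using F A0(1) by (auto simp: H_def)
  have "\<exists>n \<sigma>. 0 < (n::nat) \<and> perm_act \<sigma> (\<lambda>i. of_nat n * g i) \<in> C \<inter> Z_inf \<and>
      antimono (perm_act \<sigma> (\<lambda>i. of_nat n * g i))" if g: "g \<in> H" for g
  proof -
    have "g \<in> Q_inf" using g H(2) G(1) by blast
    then obtain n :: nat where n: "0 < n" "(\<lambda>i. of_nat n * g i) \<in> Z_inf"
      using Q_inf_common_denominator by blast
    have "g \<in> C" using g H(2) G(2) cn_base by blast
    then have ng: "(\<lambda>i. of_nat n * g i) \<in> C" using sym_coneD(3)[OF sc] by simp
    then obtain \<sigma> where "antimono (perm_act \<sigma> (\<lambda>i. of_nat n * g i))" using ex_sort C by blast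
    then show ?thesis using n ng sym_coneD(4)[OF sc ng] perm_act_Z_inf[OF n(2)] by blast
  qed
  then obtain n \<sigma> where n\<sigma>: "\<And>g. g \<in> H \<Longrightarrow> 0 < (n g :: nat)"
    "\<And>g. g \<in> H \<Longrightarrow> perm_act (\<sigma> g) (\<lambda>i. of_nat (n g) * g i) \<in> C \<inter> Z_inf"
    "\<And>g. g \<in> H \<Longrightarrow> antimono (perm_act (\<sigma> g) (\<lambda>i. of_nat (n g) * g i))"
    by metis
  define s where "s g = perm_act (\<sigma> g) (\<lambda>i. of_nat (n g) * g i)" for g
  define A where "A = s ` H"
  have A: "finite A" "A \<subseteq> C \<inter> Z_inf" "\<And>a. a \<in> A \<Longrightarrow> antimono a"
    using H(1) n\<sigma> by (auto simp: A_def s_def)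
  have domH: "dominated A (perm_act \<tau> g)" if g: "g \<in> H" for g \<tau>
  proof -
    \<comment> \<open>This permuted copy of \<open>s g\<close> is a positive multiple of
      \<open>perm_act \<tau> g\<close>, because \<open>inverse (\<sigma> g)\<close> undoes the
      sorting.\<close>
    have "dominated A (perm_act (\<tau> * inverse (\<sigma> g)) (s g))"
      by (rule dominated_perm_act) (use g A in \<open>auto simp: A_def Z_inf_def\<close>)
    then have "dominated A (\<lambda>i. of_nat (n g) * perm_act \<tau> g i)"
      by (simp add: s_def flip: perm_act_mult) (simp add: perm_act_def)
    then have "dominated A (\<lambda>i. inverse (of_nat (n g)) * (of_nat (n g) * perm_act \<tau> g i) + 0)"
      by (rule dominated_lincomb[OF _ dominated_zero]) simp
    then show ?thesis using n\<sigma>(1)[OF g] by (simp flip: mult.assoc)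
  qed
  have domF: "dominated A (perm_act \<tau> a)" if "a \<in> A0" for a \<tau>
    using F(3)[OF that]
  proof (induction rule: cn_induct)
    case zero
    then show ?case using dominated_zero by (simp add: perm_act_def)
  next
    case (add b c u)
    then have "b \<in> H" using that by (auto simp: H_def)
    then show ?case using dominated_lincomb[OF domH[of b \<tau>] add(3,2)] by (simp add: perm_act_def)
  qed
  have "dominated A y" if "y \<in> C" for y
    using that unfolding A0(2)
  proof (induction rule: cn_induct)
    case zero
    then show ?case by (rule dominated_zero)
  next
    case (add b c u)
    then show ?case using domF by (auto simp: Sym_def intro: dominated_lincomb)
  qed
  then show thesis using that A by blast
qed

text \<open>The differences of the rounded-down coefficients give a point \<open>x\<close> of the cone that majorizes \<open>y\<close>.\<close>
lemma ex_difference_mem: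
  fixes f :: "nat \<Rightarrow> nat \<Rightarrow> real"
  assumes C: "C \<subseteq> R_inf_nonneg" "sym_cone C"
    and A: "finite A" "A \<subseteq> C \<inter> Z_inf" "\<And>a. a \<in> A \<Longrightarrow> antimono a"
    and dom: "\<And>y. y \<in> C \<Longrightarrow> dominated A y"
    and f: "\<And>n. f n \<in> C \<inter> Z_inf" "\<And>n. antimono (f n)"
  obtains k l where "k < l" "(\<lambda>i. f l i - f k i) \<in> C \<inter> Z_inf"
proof -
  have f0: "f n \<in> R_inf" "0 \<le> f n i" "f n i \<in> \<int>" for n i
    using f(1)[of n] C(1) by (auto simp: R_inf_nonneg_def Z_inf_def Z_seq_def)
  have a0: "a \<in> R_inf" "0 \<le> a i" "a i \<in> \<int>" "a \<in> Z_inf" if "a \<in> A" for a i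
    using A(2) C(1) that by (auto simp: R_inf_nonneg_def Z_inf_def Z_seq_def)
  define F where "F n i = nat \<lfloor>f n i\<rfloor>" for n i
  have F: "real (F n i) = f n i" for n i
    using f0(2,3)[of n i] by (auto simp: F_def elim!: Ints_cases)
  have F_anti: "antimono (F n)" for n
  proof (rule antimonoI)
    fix i j :: nat assume "i \<le> j"
    then have "real (F n j) \<le> real (F n i)" using f(2)[of n] by (simp add: F antimono_def)
    then show "F n j \<le> F n i" by simp
  qed
  have F_supp: "{i. F n i \<noteq> 0} = {i. f n i \<noteq> 0}" for n by (auto simp flip: F)
  have F_fin: "finite {i. F n i \<noteq> 0}" for n
    using f0(1)[of n] unfolding F_supp by (simp add: R_inf_def)
  have "\<exists>d. \<forall>a\<in>A. \<forall>i\<ge>d. a i = 0"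
  proof -
    have "\<forall>a\<in>A. \<exists>N. \<forall>i\<ge>N. a i = 0" using a0(1) R_inf_bound by metis
    then obtain N where N: "\<And>a i. a \<in> A \<Longrightarrow> i \<ge> N a \<Longrightarrow> a i = 0" by metis
    have "N a \<le> Max (N ` A)" if "a \<in> A" for a using A(1) that by simp
    then show ?thesis using N by (meson le_trans)
  qed
  then obtain d0 where d0: "\<And>a i. a \<in> A \<Longrightarrow> i \<ge> d0 \<Longrightarrow> a i = 0" by blast
  define d where "d = Suc d0"
  have d: "d > 0" "\<And>a i. a \<in> A \<Longrightarrow> i \<ge> d \<Longrightarrow> a i = 0" using d0 by (auto simp: d_def)
  have "\<forall>n. \<exists>c. (\<forall>a\<in>A. 0 \<le> c a) \<and>
     (\<forall>k. sum (f n) {..<k} \<le> (\<Sum>a\<in>A. c a * sum a {..<k})) \<and> mass (f n) = (\<Sum>a\<in>A. c a * mass a)"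
    using dom f(1) unfolding dominated_def by blast
  then obtain c where c: "\<And>n a. a \<in> A \<Longrightarrow> 0 \<le> c n a"
     "\<And>n k. sum (f n) {..<k} \<le> (\<Sum>a\<in>A. c n a * sum a {..<k})"
     "\<And>n. mass (f n) = (\<Sum>a\<in>A. c n a * mass a)" by metis
  define N where "N a n = nat \<lfloor>c n a\<rfloor>" for a n
  have N: "real (N a n) \<le> c n a" "c n a - 1 \<le> real (N a n)" if "a \<in> A" for a n
    using c(1)[OF that, of n] by (auto simp: N_def)
  have a_mass: "0 \<le> sum a {..<k}" "sum a {..<k} \<le> mass a" "0 \<le> mass a" if "a \<in> A" for a k
  proof -
    show "0 \<le> sum a {..<k}" using a0(2)[OF that] by (intro sum_nonneg)
    show "sum a {..<k} \<le> mass a" by (rule sum_le_mass) (use a0(1,2)[OF that] in auto)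
    show "0 \<le> mass a" unfolding mass_def using a0(2)[OF that] by (intro sum_nonneg)
  qed
  \<comment> \<open>Rounding a coefficient down loses at most 1, hence at most \<open>mass a\<close>
    for each generator; the constant \<open>K\<close> below compensates for this.\<close>
  have sum_lower: "(\<Sum>a\<in>A. c n a * g a) \<le> (\<Sum>a\<in>A. mass a) + (\<Sum>a\<in>A. real (N a n) * g a)"
    if "\<And>a. a \<in> A \<Longrightarrow> 0 \<le> g a \<and> g a \<le> mass a" for g n
    unfolding sum.distrib[symmetric]
  proof (rule sum_mono)
    fix a assume a: "a \<in> A"
    have "c n a * g a \<le> (1 + real (N a n)) * g a"
      using N(2)[OF a, of n] that[OF a] by (intro mult_right_mono) auto
    also have "\<dots> \<le> mass a + real (N a n) * g a" using that[OF a] by (simp add: algebra_simps)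
    finally show "c n a * g a \<le> mass a + real (N a n) * g a" .
  qed
  define K where "K = (\<Sum>a\<in>A. mass a)"
  have K_int: "K \<in> \<int>" unfolding K_def using a0(4) by (intro Ints_sum mass_int)
  \<comment> \<open>Slacks of the domination inequalities with rounded coefficients. Adding
    \<open>K\<close> makes these integers nonnegative, and \<open>K\<close> cancels when two of them
    are compared.\<close>
  define Z where "Z k n = nat \<lfloor>K + (\<Sum>a\<in>A. real (N a n) * sum a {..<k}) - sum (f n) {..<k}\<rfloor>" for k n
  define T where "T n = nat \<lfloor>K + (\<Sum>a\<in>A. real (N a n) * mass a) - mass (f n)\<rfloor>" for n
  have Z: "real (Z k n) = K + (\<Sum>a\<in>A. real (N a n) * sum a {..<k}) - sum (f n) {..<k}" for k n
  proof -
    have "K + (\<Sum>a\<in>A. real (N a n) * sum a {..<k}) - sum (f n) {..<k} \<in> \<int>"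
      using K_int a0(3) f0(3) by (intro Ints_diff Ints_add Ints_sum Ints_mult Ints_of_nat) auto
    moreover have "0 \<le> K + (\<Sum>a\<in>A. real (N a n) * sum a {..<k}) - sum (f n) {..<k}"
      using sum_lower[of "\<lambda>a. sum a {..<k}" n] a_mass c(2)[where n = n and k = k] by (simp add: K_def)
    ultimately show ?thesis unfolding Z_def by (auto elim!: Ints_cases)
  qed
  have T: "real (T n) = K + (\<Sum>a\<in>A. real (N a n) * mass a) - mass (f n)" for n
  proof -
    have "K + (\<Sum>a\<in>A. real (N a n) * mass a) - mass (f n) \<in> \<int>"
      using K_int a0(4) f(1) by (intro Ints_diff Ints_add Ints_sum Ints_mult Ints_of_nat mass_int) auto
    moreover have "0 \<le> K + (\<Sum>a\<in>A. real (N a n) * mass a) - mass (f n)"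
      using sum_lower[of mass n] a_mass c(3)[of n] by (simp add: K_def)
    ultimately show ?thesis unfolding T_def by (auto elim!: Ints_cases)
  qed
  \<comment> \<open>Totals agree for the exact coefficients, so \<open>T\<close> never exceeds
    \<open>K\<close>. Being bounded, it takes the same value at the chosen pair, which yields
    equality of totals.\<close>
  have T_bound: "T n \<le> nat \<lfloor>K\<rfloor>" for n
  proof -
    have "(\<Sum>a\<in>A. real (N a n) * mass a) \<le> (\<Sum>a\<in>A. c n a * mass a)"
      using N(1) a_mass(3) by (intro sum_mono mult_right_mono) auto
    then have "real (T n) \<le> K" using T[of n] c(3)[of n] by simp
    then show ?thesis by (simp add: le_nat_floor)
  qed
  define S where "S = N ` A \<union> Z ` {..<d} \<union> {T}"
  have "finite S" using A(1) by (simp add: S_def)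
  obtain k l q where kl: "k < l" "q < d" "F k \<le> F l"
    and st: "\<And>s. s \<in> S \<Longrightarrow> s k \<le> s l"
      "\<And>s B. s \<in> S \<Longrightarrow> (\<And>n. s n \<le> B) \<Longrightarrow> s k = s l"
    and anti: "\<And>i. Suc i < d \<Longrightarrow> F l (Suc i) - F k (Suc i) \<le> F l i - F k i"
    and top: "\<And>i j. i < q \<Longrightarrow> q \<le> j \<Longrightarrow> F l j - F k j \<le> F l i - F k i"
    and tail: "\<And>j. q \<le> j \<Longrightarrow> (d - q) * (F l j - F k j) \<le> (\<Sum>i | q \<le> i \<and> F l i \<noteq> 0. F l i - F k i)"
    using ex_partition_pair[of F S d "\<lambda>s. s", OF F_anti F_fin \<open>finite S\<close> d(1)] by blast
  define y where "y i = f l i - f k i" for i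
  have yF: "y i = real (F l i - F k i)" for i
    using kl(3) by (simp add: y_def le_fun_def of_nat_diff F)
  have yR: "y \<in> R_inf" "mass y = mass (f l) - mass (f k)"
    using R_inf_lincomb[OF f0(1)[of l] f0(1)[of k], of 1 "-1"] by (simp_all add: y_def[abs_def])
  have y: "y \<in> R_inf_nonneg" using yR by (simp add: R_inf_nonneg_def yF)
  define e where "e a = real (N a l - N a k)" for a
  have e: "e a = real (N a l) - real (N a k)" if "a \<in> A" for a
    using st(1)[of "N a"] that by (simp add: e_def S_def of_nat_diff)
  define x where "x i = (\<Sum>a\<in>A. e a * a i)" for i
  have "x \<in> C" using sym_cone_sum[OF C(2) A(1), of e] A(2) by (auto simp: x_def[abs_def] e_def)
  have x_anti: "antimono x"
    using A(3) by (auto simp: antimono_def x_def e_def intro!: sum_mono mult_left_mono)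
  have x_supp: "x i = 0" if "i \<ge> d" for i
    unfolding x_def using d(2) that by (intro sum.neutral) auto
  have x_sum: "sum x {..<j} = (\<Sum>a\<in>A. real (N a l) * sum a {..<j}) - (\<Sum>a\<in>A. real (N a k) * sum a {..<j})" for j
  proof -
    have "sum x {..<j} = (\<Sum>a\<in>A. e a * sum a {..<j})"
      unfolding x_def by (subst sum.swap) (simp add: sum_distrib_left)
    also have "\<dots> = (\<Sum>a\<in>A. real (N a l) * sum a {..<j} - real (N a k) * sum a {..<j})"
      by (rule sum.cong) (auto simp: e algebra_simps)
    finally show ?thesis by (simp add: sum_subtractf)
  qed
  \<comment> \<open>That the slack \<open>Z j\<close> does not decrease from \<open>k\<close> to
    \<open>l\<close> is exactly this inequality for the differences.\<close>
  have pre: "sum y {..<j} \<le> sum x {..<j}" if "j \<le> q" for j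
  proof -
    have "Z j k \<le> Z j l" using st(1)[of "Z j"] that kl(2) by (simp add: S_def)
    then have "real (Z j k) \<le> real (Z j l)" by simp
    then show ?thesis unfolding Z x_sum by (simp add: y_def sum_subtractf)
  qed
  have "T k = T l" using st(2)[of T] T_bound by (auto simp: S_def)
  then have "real (T k) = real (T l)" by simp
  moreover have "mass a = sum a {..<d}" if "a \<in> A" for a using d(2) that by (intro mass_lessThan)
  ultimately have tot: "mass y = sum x {..<d}" unfolding T x_sum yR(2) by simp
  have y_tail: "mass y - sum y {..<q} = (\<Sum>i | q \<le> i \<and> F l i \<noteq> 0. y i)"
  proof -
    have "mass y = sum y ({..<q} \<union> {i. q \<le> i \<and> F l i \<noteq> 0})"
      by (rule mass_eq) (use F_fin[of l] in \<open>auto simp: yF intro: finite_subset\<close>)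
    also have "\<dots> = sum y {..<q} + (\<Sum>i | q \<le> i \<and> F l i \<noteq> 0. y i)"
      using F_fin[of l] by (intro sum.union_disjoint) (auto intro: finite_subset)
    finally show ?thesis by simp
  qed
  have "y \<in> C"
  proof (rule subset_sums_mem[OF C(2) y \<open>x \<in> C\<close>])
    show "x \<in> R_inf" using x_supp by (rule R_infI)
    show "mass y = mass x" using tot mass_lessThan[of d x] x_supp by simp
    show "sum y I \<le> sum x {..<card I}" if "finite I" for I
    proof (rule subset_sums_le[OF x_anti x_supp y kl(2) tot pre _ _ _ that])
      show "y (Suc i) \<le> y i" if "Suc i < d" for i using anti[OF that] by (simp add: yF)
      show "y j \<le> y i" if "i < q" "q \<le> j" for i j using top[OF that] by (simp add: yF)
      show "real (d - q) * y j \<le> mass y - sum y {..<q}" if "q \<le> j" for j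
      proof -
        have "real ((d - q) * (F l j - F k j)) \<le> real (\<Sum>i | q \<le> i \<and> F l i \<noteq> 0. F l i - F k i)"
          using tail[OF that] by (rule of_nat_mono)
        then show ?thesis unfolding y_tail yF by simp
      qed
    qed
  qed
  moreover have "y \<in> Z_inf" using yR f0(3) by (simp add: Z_inf_def Z_seq_def y_def)
  ultimately show thesis using that kl(1) by (auto simp: y_def[abs_def])
qed

section \<open>Decomposition into irreducible elements\<close>

definition irreducibles :: "(nat \<Rightarrow> real) set \<Rightarrow> (nat \<Rightarrow> real) set" where
  "irreducibles M = {u \<in> M. u \<noteq> (\<lambda>i. 0) \<and>
     (\<forall>v\<in>M. \<forall>w\<in>M. u = (\<lambda>i. v i + w i) \<longrightarrow> v = (\<lambda>i. 0) \<or> w = (\<lambda>i. 0))}"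

lemma irreduciblesD:
  assumes "u \<in> irreducibles M" "v \<in> M" "w \<in> M" "u = (\<lambda>i. v i + w i)"
  shows "v = (\<lambda>i. 0) \<or> w = (\<lambda>i. 0)"
  using assms unfolding irreducibles_def by blast

lemma perm_act_zero_iff: "perm_act \<sigma> v = (\<lambda>i. 0) \<longleftrightarrow> v = (\<lambda>i. 0)"
proof
  assume "perm_act \<sigma> v = (\<lambda>i. 0)"
  then have "perm_act (inverse \<sigma>) (perm_act \<sigma> v) = perm_act (inverse \<sigma>) (\<lambda>i. 0)" by simp
  then show "v = (\<lambda>i. 0)" unfolding perm_act_inverse by (simp add: perm_act_def)
qed (simp add: perm_act_def)

lemma perm_act_irreducibles:
  assumes "\<And>u \<tau>. u \<in> M \<Longrightarrow> perm_act \<tau> u \<in> M" "u \<in> irreducibles M"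
  shows "perm_act \<sigma> u \<in> irreducibles M"
proof -
  have "v = (\<lambda>i. 0) \<or> w = (\<lambda>i. 0)"
    if "v \<in> M" "w \<in> M" "perm_act \<sigma> u = (\<lambda>i. v i + w i)" for v w
  proof -
    have "u = perm_act (inverse \<sigma>) (\<lambda>i. v i + w i)" by (simp flip: that(3))
    then have "u = (\<lambda>i. perm_act (inverse \<sigma>) v i + perm_act (inverse \<sigma>) w i)"
      by (simp add: perm_act_def)
    then show ?thesis using assms that(1,2) perm_act_zero_iff unfolding irreducibles_def by blast
  qed
  then show ?thesis using assms by (auto simp: irreducibles_def perm_act_zero_iff)
qed

theorem theorem6p1:
  fixes C :: "(nat \<Rightarrow> real) set"
  assumes "C \<subseteq> R_inf_nonneg"
    and "rational_cone C"
    and "Sym_fg_cone C"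
  shows "normal_monoid (C \<inter> Z_inf) \<and> Sym_fg_monoid (C \<inter> Z_inf)"
proof -
  define M where "M = C \<inter> Z_inf"
  have sc: "sym_cone C" using assms(3) sym_cone_cn_Sym by (auto simp: Sym_fg_cone_def)
  obtain A where A: "finite A" "A \<subseteq> C \<inter> Z_inf" "\<And>a. a \<in> A \<Longrightarrow> antimono a"
    "\<And>y. y \<in> C \<Longrightarrow> dominated A y"
    using ex_dominating_generators[OF assms] by blast
  have M0: "(\<lambda>i. 0) \<in> M"
    using sym_coneD(1)[OF sc] by (simp add: M_def Z_inf_def Z_seq_def zero_R_inf)
  have M_add: "(\<lambda>i. u i + v i) \<in> M" if "u \<in> M" "v \<in> M" for u v
    using that sym_coneD(2)[OF sc] R_inf_add(1) by (auto simp: M_def Z_inf_def Z_seq_def)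
  have M_perm: "perm_act \<sigma> u \<in> M" if "u \<in> M" for u \<sigma>
    using that sym_coneD(4)[OF sc] perm_act_Z_inf by (auto simp: M_def)
  have M_nonneg: "u \<in> R_inf" "0 \<le> u i" "u \<in> R_inf_nonneg" "u \<in> Z_inf" if "u \<in> M" for u i
    using that assms(1) by (auto simp: M_def R_inf_nonneg_def)
  \<comment> \<open>Normality: the cone allows division by \<open>k\<close>, and integrality of
    \<open>u\<close> is assumed.\<close>
  have "u \<in> M" if "u \<in> Z_seq" "0 < k" "(\<lambda>i. of_nat k * u i) \<in> M" for u and k :: nat
  proof -
    have "(\<lambda>i. of_nat k * u i) \<in> C" using that(3) by (simp add: M_def)
    from sym_coneD(3)[OF sc this, of "inverse (of_nat k)"]
    have "(\<lambda>i. inverse (of_nat k) * (of_nat k * u i)) \<in> C" by simp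
    moreover have "(\<lambda>i. inverse (of_nat k) * (of_nat k * u i)) \<in> R_inf"
      by (rule R_inf_scale(1)[OF M_nonneg(1)[OF that(3)]])
    moreover have "(\<lambda>i. inverse (of_nat k) * (of_nat k * u i)) = u"
      using that(2) by (simp flip: mult.assoc)
    ultimately show ?thesis using that(1) by (simp add: M_def Z_inf_def)
  qed
  then have normal: "normal_monoid M"
    using M0 M_add by (auto simp: normal_monoid_def M_def Z_inf_def)
  \<comment> \<open>Every orbit of irreducible elements has a decreasing representative, and
    permutations preserve irreducibility.\<close>
  define B where "B = {u \<in> irreducibles M. antimono u}"
  have BM: "B \<subseteq> M" by (auto simp: B_def irreducibles_def)
  have "finite B"
  proof (rule ccontr)
    assume "infinite B"
    then obtain f :: "nat \<Rightarrow> nat \<Rightarrow> real" where f: "inj f" "range f \<subseteq> B"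
      using infinite_countable_subset by blast
    have fB: "f n \<in> B" for n using f(2) by blast
    obtain k l where kl: "k < l" "(\<lambda>i. f l i - f k i) \<in> C \<inter> Z_inf"
      by (rule ex_difference_mem[OF assms(1) sc A, of f]) (use fB BM in \<open>auto simp: B_def M_def\<close>)
    \<comment> \<open>The later vector \<open>f l\<close> is the sum of \<open>f k\<close> and this
      difference, both in \<open>M\<close>.\<close>
    have "f k = (\<lambda>i. 0) \<or> (\<lambda>i. f l i - f k i) = (\<lambda>i. 0)"
    proof (rule irreduciblesD)
      show "f l \<in> irreducibles M" using fB[of l] by (simp add: B_def)
      show "f k \<in> M" using fB[of k] BM by blast
      show "(\<lambda>i. f l i - f k i) \<in> M" using kl(2) by (simp add: M_def)
    qed simp
    moreover have "f k \<noteq> (\<lambda>i. 0)" using fB[of k] by (simp add: B_def irreducibles_def)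
    moreover have "f l \<noteq> f k" using f(1) kl(1) by (auto dest: injD)
    ultimately show False by (auto simp: fun_eq_iff)
  qed
  have "u \<in> mn (Sym B)" if "u \<in> M" for u
    using that
  \<comment> \<open>Entries are nonnegative integers, so both summands of a nontrivial decomposition
    have smaller mass.\<close>
  proof (induction "nat \<lfloor>mass u\<rfloor>" arbitrary: u rule: less_induct)
    case less
    show ?case
    proof (cases "u = (\<lambda>i. 0)")
      case True
      then show ?thesis using mn_zero by simp
    next
      case nz: False
      show ?thesis
      proof (cases "u \<in> irreducibles M")
        case True
        obtain \<sigma> where \<sigma>: "antimono (perm_act \<sigma> u)" using ex_sort[OF M_nonneg(3)[OF less.prems]] by blast
        then have "perm_act \<sigma> u \<in> B"
          using perm_act_irreducibles[OF M_perm True] by (simp add: B_def)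
        then have "perm_act (inverse \<sigma>) (perm_act \<sigma> u) \<in> Sym B" unfolding Sym_def by blast
        then show ?thesis by (intro mn_base) simp
      next
        case False
        then obtain v w where vw: "v \<in> M" "w \<in> M" "u = (\<lambda>i. v i + w i)"
          "v \<noteq> (\<lambda>i. 0)" "w \<noteq> (\<lambda>i. 0)"
          using less.prems nz by (auto simp: irreducibles_def)
        have m: "mass u = mass v + mass w" using R_inf_add(2) vw M_nonneg(1) by simp
        have pos: "0 < mass v" "0 < mass w" using vw M_nonneg by (auto intro!: mass_pos)
        have "mass v \<in> \<int>" "mass w \<in> \<int>" using vw M_nonneg(4) mass_int by auto
        then have "nat \<lfloor>mass v\<rfloor> < nat \<lfloor>mass u\<rfloor>" "nat \<lfloor>mass w\<rfloor> < nat \<lfloor>mass u\<rfloor>"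
          using pos m by (auto elim!: Ints_cases)
        then have "v \<in> mn (Sym B)" "w \<in> mn (Sym B)" using less.hyps vw(1,2) by blast+
        then show ?thesis using mn_add vw(3) by blast
      qed
    qed
  qed
  moreover have "mn (Sym B) \<subseteq> M"
    by (rule mn_subset) (use BM M_perm M0 M_add in \<open>auto simp: Sym_def\<close>)
  ultimately have "M = mn (Sym B)" by blast
  then have "Sym_fg_monoid M"
    unfolding Sym_fg_monoid_def using \<open>finite B\<close> BM by (auto simp: M_def)
  then show ?thesis using normal by (simp add: M_def)
qed

end
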